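(* Let $G=(V,E)$ be a decomposable graph with cliques $C_1,\dots,C_k$ in a perfect order, and let $p$ be a strictly positive probability vector on $\mathcal I$, Markov with respect to $G$. Let $D\subseteq C_l$ with $D\cap R_l\neq\emptyset$ and let $i_D\in\mathcal I_D^*$. Then: (a) (for $2\le l\le k$) $$\theta^{C_l}(i_D)=\sum_{F\subseteq D\cap S_l}(-1)^{|(D\cap S_l)\setminus F|}\;\theta^{R_l|(i_F,\,i^*_{S_l\setminus F})}(i_{D\cap R_l}),$$ which is equivalent to: for $\emptyset\ne D\subseteq R_l$, $i_D\in\mathcal I_D^*$, $F\subseteq S_l$ (possibly empty), $i_F\in\mathcal I_F^*$, $$\theta^{R_l|(i_F,\,i^*_{S_l\setminus F})}(i_D)=\sum_{H\subseteq F}\theta^{C_l}(i_H,i_D),$$ where the sums over $F\subseteq D\cap S_l$ and over $H\subseteq F$ include the empty set. (b) Let $\{>l\}$ denote the set of $j\in\{l+1,\dots,k\}$ such that $C_l\cap C_j\neq\emptyset$. (i) If $D\not\subseteq S_j$ for every $j\in\{>l\}$, then $\theta(i_D)=\theta^{C_l}(i_D)$. (ii) If $D\subseteq S_m$ for some $m\in\{>l\}$, then $$\theta(i_D)=\theta^{C_l}(i_D)-\sum_{F\subseteq D}(-1)^{|D\setminus F|}\,k_l(i_F)$$ (the sum includes $F=\emptyset$), where, with $C_{>l}=\bigcup_{m>l}(C_m\setminus C_l)$, $$k_l(i_F)=\log\Big(1+\sum_{\emptyset\ne L\subseteq C_{>l}}\ \sum_{j_L\in\mathcal I_L^*}\exp\sum_{K\subseteq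 F,\ \emptyset\neq M\subseteq L}\theta(i_K,j_M)\Big)$$ (with $K=\emptyset$ allowed, and $\theta(i_\emptyset,j_M)=\theta(j_M)$). Moreover, all the parameters $\theta(i_H,j_M)$ entering $k_l(i_F)$ (that is, $H\subseteq F$ possibly empty, $\emptyset\ne M\subseteq C_{>l}$, $j_M\in\mathcal I_M^*$) are such that $H\cup M\subseteq C_m$ for some $m\in\{>l\}$, and each is therefore either equal to $\theta^{C_m}(i_H,j_M)$ or can be expressed in terms of the parameters $\theta^{C_m}(i_E)$, $m\in\{>l\}$, $\emptyset\ne E\subseteq C_m$, $i_E\in\mathcal I^*_E$.
   Context: $V$ is a finite nonempty set. For each $\gamma\in V$, $\mathcal I_\gamma$ is a finite set of levels containing a distinguished level denoted $0=i^*_\gamma$. $\mathcal I=\prod_{\gamma\in V}\mathcal I_\gamma$, $\mathcal I_D=\prod_{\gamma\in D}\mathcal I_\gamma$, $i^*=(i^*_\gamma)_{\gamma\in V}$; $i_D$ denotes restriction to $D$; $\mathcal I_D^*=\{i_D\in\mathcal I_D: i_\gamma\neq i_\gamma^*\ \forall\gamma\in D\}$. If $i_D\in\mathcal I_D^*$ and $F\subseteq D$, then $i_F$ is the restriction of $i_D$ (likewise $j_M$ is the restriction of $j_L$ for $M\subseteq L$). For disjoint $A,B$, $(i_A,i_B)$ is the combined cell in $\mathcal I_{A\cup B}$. Cliques are maximal complete subsets. For an ordering $C_1,\dots,C_k$ of the cliques, $H_l=\bigcup_{j\le l}C_j$, and for $l\ge2$, $S_l=H_{l-1}\cap C_l$,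 $R_l=C_l\setminus S_l$; by convention $R_1=C_1$. The order is perfect if for each $l>1$ there is $i<l$ with $S_l\subseteq C_i$. $p$ is Markov with respect to $G$ if $X_\gamma, X_\delta$ are conditionally independent given the remaining variables whenever $\gamma\neq\delta$ and $\{\gamma,\delta\}\notin E$. $p^D(i_D)=\sum_{j\in\mathcal I:j_D=i_D}p(j)$ and $p^{A|i_B}(i_A)=p^{A\cup B}(i_A,i_B)/p^B(i_B)$. In the following products $F=\emptyset$ is included and $D\neq\emptyset$, $i_D\in\mathcal I_D^*$: - $\theta(i_D)=\log\prod_{F\subseteq D}p(i_F,i^*_{V\setminus F})^{(-1)^{|D\setminus F|}}$ for $D\subseteq V$. (Since $p$ is Markov, $\theta(i_D)=0$ whenever $D$ is not complete.) - $\theta^{C_l}(i_D)=\log\prod_{F\subseteq D}\big(p^{C_l}(i_F,i^*_{C_l\setminus F})\big)^{(-1)^{|D\setminus F|}}$ for $D\subseteq C_l$. - $\theta^{R_l|i_{S_l}}(i_D)=\log\prod_{F\subseteq D}\big(p^{R_l|i_{S_l}}(i_F,i^*_{R_l\setminus F})\big)^{(-1)^{|D\setminus F|}}$ for $l\ge 2$, $D\subseteq R_l$, $i_{S_l}\in\mathcal I_{S_l}$.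
   Formalization: The "Moreover" sentence is false as printed (path 1-2-3-4, l=1: θ(j_4) enters k_1). Proved instead: θ(i_H,j_M)=0 if H∪M is not complete; else it is expressible from all cliques C_m ⊇ H∪M, equal to θ^{C_m} if only one; these lie in {>l} if H≠∅ and M⊄H_{l-1}. *)

theory Defs
  imports "HOL-Analysis.Analysis"
begin

section \<open>Graphs\<close>

definition simple_graph :: "'v set \<Rightarrow> 'v set set \<Rightarrow> bool" where
  "simple_graph V E \<longleftrightarrow> (\<forall>e\<in>E. e \<subseteq> V \<and> card e = 2)"

definition complete_in :: "'v set set \<Rightarrow> 'v set \<Rightarrow> bool" where
  "complete_in E A \<longleftrightarrow> (\<forall>x\<in>A. \<forall>y\<in>A. x \<noteq> y \<longrightarrow> {x, y} \<in> E)"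

definition cliques :: "'v set \<Rightarrow> 'v set set \<Rightarrow> 'v set set" where
  "cliques V E = {A. A \<subseteq> V \<and> complete_in E A \<and>
     (\<forall>B. A \<subseteq> B \<and> B \<subseteq> V \<and> complete_in E B \<longrightarrow> B = A)}"

text \<open>Lauritzen's recursive definition: the subgraph induced on a set is decomposable if the set
  is complete or there is a proper decomposition into two decomposable parts. As \<open>A\<close>, \<open>S\<close>, \<open>B\<close>
  partition the vertices, \<open>S\<close> separates \<open>A\<close> from \<open>B\<close> iff no edge joins \<open>A\<close> and \<open>B\<close>.\<close>

inductive decomposable :: "'v set set \<Rightarrow> 'v set \<Rightarrow> bool" for E :: "'v set set" where
  complete: "complete_in E A \<Longrightarrow> decomposable E A"
| decompose: "\<lbrakk>A \<noteq> {}; B \<noteq> {}; A \<inter> B = {}; A \<inter> S = {}; B \<inter> S = {}; complete_in E S;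
     \<forall>a\<in>A. \<forall>b\<in>B. {a, b} \<notin> E; decomposable E (A \<union> S); decomposable E (B \<union> S)\<rbrakk>
     \<Longrightarrow> decomposable E (A \<union> B \<union> S)"

text \<open>Cliques are indexed from 1. Since \<open>hist C 0 = {}\<close>, we get \<open>sep C 1 = {}\<close>, and \<open>res C 1 = C 1\<close>
  is the usual convention.\<close>

definition hist :: "(nat \<Rightarrow> 'v set) \<Rightarrow> nat \<Rightarrow> 'v set" where
  "hist C l = (\<Union>j\<in>{1..l}. C j)"

definition sep :: "(nat \<Rightarrow> 'v set) \<Rightarrow> nat \<Rightarrow> 'v set" where
  "sep C l = hist C (l - 1) \<inter> C l"

definition res :: "(nat \<Rightarrow> 'v set) \<Rightarrow> nat \<Rightarrow> 'v set" where
  "res C l = C l - sep C l"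

definition perfect_order :: "'v set \<Rightarrow> 'v set set \<Rightarrow> (nat \<Rightarrow> 'v set) \<Rightarrow> nat \<Rightarrow> bool" where
  "perfect_order V E C k \<longleftrightarrow> bij_betw C {1..k} (cliques V E) \<and>
     (\<forall>l\<in>{2..k}. \<exists>i\<in>{1..<l}. sep C l \<subseteq> C i)"

definition later :: "(nat \<Rightarrow> 'v set) \<Rightarrow> nat \<Rightarrow> nat \<Rightarrow> nat set" where
  "later C k l = {j\<in>{l+1..k}. C l \<inter> C j \<noteq> {}}"

definition C_later :: "(nat \<Rightarrow> 'v set) \<Rightarrow> nat \<Rightarrow> nat \<Rightarrow> 'v set" where
  "C_later C k l = (\<Union>m\<in>{l+1..k}. C m - C l)"

section \<open>Cells, marginal and conditional probabilities\<close>

text \<open>A cell of \<open>\<I>\<^sub>D\<close> is an extensional function in \<open>PiE D lev\<close>, where \<open>lev \<gamma>\<close> is the set of levels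
  of \<open>\<gamma>\<close> and \<open>istar \<gamma>\<close> the distinguished one. The combined cell \<open>(i\<^sub>A, j\<^sub>B)\<close> is
  \<open>merge A B (i, j)\<close>, which only looks at \<open>i\<close> on \<open>A\<close> and at \<open>j\<close> on \<open>B\<close>.\<close>

definition nz_cells :: "('v \<Rightarrow> 'a set) \<Rightarrow> ('v \<Rightarrow> 'a) \<Rightarrow> 'v set \<Rightarrow> ('v \<Rightarrow> 'a) set" where
  "nz_cells lev istar D = PiE D (\<lambda>\<gamma>. lev \<gamma> - {istar \<gamma>})"

definition pos_prob :: "'v set \<Rightarrow> ('v \<Rightarrow> 'a set) \<Rightarrow> (('v \<Rightarrow> 'a) \<Rightarrow> real) \<Rightarrow> bool" where
  "pos_prob V lev p \<longleftrightarrow> (\<forall>i\<in>PiE V lev. p i > 0) \<and> (\<Sum>i\<in>PiE V lev. p i) = 1"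

definition marginal ::
  "'v set \<Rightarrow> ('v \<Rightarrow> 'a set) \<Rightarrow> (('v \<Rightarrow> 'a) \<Rightarrow> real) \<Rightarrow> 'v set \<Rightarrow> ('v \<Rightarrow> 'a) \<Rightarrow> real" where
  "marginal V lev p D x = (\<Sum>j\<in>{j\<in>PiE V lev. restrict j D = x}. p j)"

text \<open>\<open>conditional V lev p A B s\<close> is \<open>p\<^bsup>A|s\<^esup>\<close> for \<open>s\<close> in \<open>PiE B lev\<close>.\<close>

definition conditional ::
  "'v set \<Rightarrow> ('v \<Rightarrow> 'a set) \<Rightarrow> (('v \<Rightarrow> 'a) \<Rightarrow> real) \<Rightarrow> 'v set \<Rightarrow> 'v set \<Rightarrow> ('v \<Rightarrow> 'a) \<Rightarrow>
     ('v \<Rightarrow> 'a) \<Rightarrow> real" where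
  "conditional V lev p A B s x = marginal V lev p (A \<union> B) (merge A B (x, s)) / marginal V lev p B s"

definition markov ::
  "'v set \<Rightarrow> 'v set set \<Rightarrow> ('v \<Rightarrow> 'a set) \<Rightarrow> (('v \<Rightarrow> 'a) \<Rightarrow> real) \<Rightarrow> bool" where
  "markov V E lev p \<longleftrightarrow>
     (\<forall>\<gamma>\<in>V. \<forall>\<delta>\<in>V. \<gamma> \<noteq> \<delta> \<and> {\<gamma>, \<delta>} \<notin> E \<longrightarrow>
       (\<forall>x\<in>PiE V lev. let B = V - {\<gamma>, \<delta>}; s = restrict x B in
          conditional V lev p {\<gamma>, \<delta>} B s (restrict x {\<gamma>, \<delta>}) =
          conditional V lev p {\<gamma>} B s (restrict x {\<gamma>}) *
          conditional V lev p {\<delta>} B s (restrict x {\<delta>})))"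

section \<open>Log-linear parameters\<close>

definition interaction ::
  "('v \<Rightarrow> 'a) \<Rightarrow> (('v \<Rightarrow> 'a) \<Rightarrow> real) \<Rightarrow> 'v set \<Rightarrow> 'v set \<Rightarrow> ('v \<Rightarrow> 'a) \<Rightarrow> real" where
  "interaction istar q A D i =
     ln (\<Prod>F\<in>Pow D. q (merge F (A - F) (i, istar)) powi ((- 1) ^ card (D - F)))"

text \<open>In the next three definitions \<open>D\<close> is the set carrying the cell \<open>i\<close>; only the values of \<open>i\<close> on
  \<open>D\<close> matter, so a cell of a larger set may be passed in place of its restriction.\<close>

definition theta ::
  "'v set \<Rightarrow> ('v \<Rightarrow> 'a) \<Rightarrow> (('v \<Rightarrow> 'a) \<Rightarrow> real) \<Rightarrow> 'v set \<Rightarrow> ('v \<Rightarrow> 'a) \<Rightarrow> real" where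
  "theta V istar p D i = interaction istar p V D i"

definition theta_marg ::
  "'v set \<Rightarrow> ('v \<Rightarrow> 'a set) \<Rightarrow> ('v \<Rightarrow> 'a) \<Rightarrow> (('v \<Rightarrow> 'a) \<Rightarrow> real) \<Rightarrow> 'v set \<Rightarrow>
     'v set \<Rightarrow> ('v \<Rightarrow> 'a) \<Rightarrow> real" where
  "theta_marg V lev istar p A D i = interaction istar (marginal V lev p A) A D i"

text \<open>\<open>theta_cond V lev istar p R S s\<close> is \<open>\<theta>\<^bsup>R|s\<^esup>\<close> for \<open>s\<close> in \<open>PiE S lev\<close>.\<close>

definition theta_cond ::
  "'v set \<Rightarrow> ('v \<Rightarrow> 'a set) \<Rightarrow> ('v \<Rightarrow> 'a) \<Rightarrow> (('v \<Rightarrow> 'a) \<Rightarrow> real) \<Rightarrow> 'v set \<Rightarrow> 'v set \<Rightarrow>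
     ('v \<Rightarrow> 'a) \<Rightarrow> 'v set \<Rightarrow> ('v \<Rightarrow> 'a) \<Rightarrow> real" where
  "theta_cond V lev istar p R S s D i = interaction istar (conditional V lev p R S s) R D i"

text \<open>\<open>k_l(i\<^sub>F)\<close> is the case \<open>B = C_later C k l\<close>.\<close>

definition k_fun ::
  "'v set \<Rightarrow> ('v \<Rightarrow> 'a set) \<Rightarrow> ('v \<Rightarrow> 'a) \<Rightarrow> (('v \<Rightarrow> 'a) \<Rightarrow> real) \<Rightarrow> 'v set \<Rightarrow>
     'v set \<Rightarrow> ('v \<Rightarrow> 'a) \<Rightarrow> real" where
  "k_fun V lev istar p B F i =
     ln (1 + (\<Sum>L\<in>Pow B - {{}}. \<Sum>j\<in>nz_cells lev istar L.
       exp (\<Sum>K\<in>Pow F. \<Sum>M\<in>Pow L - {{}}. theta V istar p (K \<union> M) (merge K M (i, j)))))"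

text \<open>\<open>\<theta>(x\<^sub>D)\<close> can be expressed in terms of the parameters \<open>\<theta>\<^bsup>C\<^sub>m\<^esup>(y\<^sub>B)\<close>, \<open>m \<in> J\<close>, \<open>\<emptyset> \<noteq> B \<subseteq> C\<^sub>m\<close>,
  \<open>y\<^sub>B \<in> \<I>\<^sub>B\<^sup>*\<close>: a single function of these parameters gives \<open>\<theta>(x\<^sub>D)\<close> for every strictly positive
  Markov probability vector. Entries of the parameter family outside this range are set to 0, so
  that they carry no information.

  For the parameters \<open>\<theta>(i\<^sub>H, j\<^sub>M)\<close> entering \<open>k_l\<close>, the set \<open>later C k l\<close> cannot be used as \<open>J\<close>
  throughout: for the path 1-2-3-4 with cliques {1,2}, {2,3}, {3,4} and \<open>l = 1\<close> one has
  \<open>later C 3 1 = {2}\<close>, while \<open>\<theta>(j\<^sub>4)\<close> enters \<open>k_1\<close> and is not determined by the marginal on {2,3}.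
  The right \<open>J\<close> is the set of all cliques containing \<open>H \<union> M\<close>; it lies in \<open>later C k l\<close> if
  \<open>H \<noteq> \<emptyset>\<close> and \<open>M\<close> is not contained in the earlier cliques, and in \<open>{l+1..k}\<close> if only the latter
  holds.\<close>

definition expressible_from ::
  "'v set \<Rightarrow> 'v set set \<Rightarrow> ('v \<Rightarrow> 'a set) \<Rightarrow> ('v \<Rightarrow> 'a) \<Rightarrow> (nat \<Rightarrow> 'v set) \<Rightarrow> nat set \<Rightarrow>
     'v set \<Rightarrow> ('v \<Rightarrow> 'a) \<Rightarrow> bool" where
  "expressible_from V E lev istar C J D x \<longleftrightarrow>
     (\<exists>\<Phi> :: (nat \<Rightarrow> 'v set \<Rightarrow> ('v \<Rightarrow> 'a) \<Rightarrow> real) \<Rightarrow> real.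
       \<forall>q. pos_prob V lev q \<and> markov V E lev q \<longrightarrow>
         theta V istar q D x =
         \<Phi> (\<lambda>m B y. if m \<in> J \<and> B \<noteq> {} \<and> B \<subseteq> C m \<and> y \<in> nz_cells lev istar B
                   then theta_marg V lev istar q (C m) B y else 0))"

end

theory Submission
  imports Defs
begin

text \<open>All parameters are Moebius transforms over subsets \<open>F\<close> of \<open>D\<close> of log marginals at the cells
  \<open>(i\<^sub>F, i\<^sup>*)\<close>, and such a transform vanishes when the function only depends on \<open>F \<inter> S\<close> for some \<open>S\<close>
  not containing \<open>D\<close>. Along a perfect order \<open>p\<close> factorizes as \<open>\<Prod>\<^sub>m p\<^bsup>C\<^sub>m\<^esup> / p\<^bsup>S\<^sub>m\<^esup>\<close>, so
  \<open>\<theta>(i\<^sub>D)\<close> is the sum of \<open>\<theta>\<^bsup>C\<^sub>m\<^esup>(i\<^sub>D) - \<theta>\<^bsup>S\<^sub>m\<^esup>(i\<^sub>D)\<close> over the cliques \<open>C\<^sub>m\<close> containing \<open>D\<close>; this yields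
  (b)(i) and the statements on the parameters entering \<open>k\<^sub>l\<close>. For (b)(ii), adding
  \<open>k\<^sub>l(i\<^sub>F)\<close> to \<open>ln p(i\<^sub>F, i\<^sup>*)\<close> amounts to summing \<open>p\<close> over the coordinates in \<open>C\<^bsub>>l\<^esub>\<close>. The result is a marginal on some \<open>A\<close>
  with \<open>C\<^sub>l \<subseteq> A \<subseteq> H\<^sub>l\<close>, and it is \<open>p\<^bsup>R\<^sub>l|S\<^sub>l\<^esup>\<close> times a factor without
  the coordinates in \<open>R\<^sub>l\<close>, exactly as \<open>p\<^bsup>C\<^sub>l\<^esup>\<close> is. Part (a) is pure Moebius inversion.\<close>

section \<open>Moebius transforms on subsets\<close>

definition mobius :: "('v set \<Rightarrow> real) \<Rightarrow> 'v set \<Rightarrow> real" where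
  "mobius f D = (\<Sum>F\<in>Pow D. (- 1) ^ card (D - F) * f F)"

lemma sum_Pow_insert:
  fixes g :: "'v set \<Rightarrow> 'b::comm_monoid_add"
  assumes "finite D" "a \<notin> D"
  shows "(\<Sum>F\<in>Pow (insert a D). g F) = (\<Sum>F\<in>Pow D. g F + g (insert a F))"
proof -
  have "inj_on (insert a) (Pow D)"
    using assms(2) by (auto simp: inj_on_def)
  moreover have "Pow D \<inter> insert a ` Pow D = {}"
    using assms(2) by auto
  ultimately show ?thesis
    using assms(1) by (simp add: Pow_insert sum.union_disjoint sum.reindex sum.distrib)
qed

lemma mobius_cong: "(\<And>F. F \<subseteq> D \<Longrightarrow> f F = g F) \<Longrightarrow> mobius f D = mobius g D"
  by (auto simp: mobius_def intro!: sum.cong)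

lemma mobius_add: "mobius (\<lambda>F. f F + g F) D = mobius f D + mobius g D"
  by (simp add: mobius_def distrib_left sum.distrib)

lemma mobius_diff: "mobius (\<lambda>F. f F - g F) D = mobius f D - mobius g D"
  by (simp add: mobius_def right_diff_distrib sum_subtractf)

lemma mobius_sum: "mobius (\<lambda>F. \<Sum>m\<in>I. f m F) D = (\<Sum>m\<in>I. mobius (f m) D)"
  unfolding mobius_def sum_distrib_left by (rule sum.swap)

lemma mobius_empty [simp]: "mobius f {} = f {}"
  by (simp add: mobius_def)

text \<open>A subset containing \<open>a\<close> keeps its complement; one avoiding \<open>a\<close>
  gains \<open>a\<close> there and changes sign. This recursion drives the inductions below.\<close>

lemma mobius_insert:
  assumes "finite D" "a \<notin> D"
  shows "mobius f (insert a D) = mobius (\<lambda>F. f (insert a F)) D - mobius f D"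
proof -
  have "card (insert a D - F) = Suc (card (D - F))" "insert a D - insert a F = D - F"
    if "F \<subseteq> D" for F
  proof -
    have "insert a D - F = insert a (D - F)"
      using that assms by auto
    then show "card (insert a D - F) = Suc (card (D - F))"
      using assms by simp
    show "insert a D - insert a F = D - F"
      using assms by auto
  qed
  then show ?thesis
    unfolding mobius_def sum_Pow_insert[OF assms] sum_subtractf[symmetric]
    by (intro sum.cong) auto
qed

text \<open>For \<open>a\<close> in \<open>D\<close> outside \<open>S\<close>, the terms of
  \<open>F\<close> and \<open>insert a F\<close> cancel. With \<open>S = {}\<close> this kills
  constants on a nonempty \<open>D\<close>.\<close>

lemma mobius_eq_0:
  assumes "finite D" "\<not> D \<subseteq> S" "\<And>F. F \<subseteq> D \<Longrightarrow> f (F \<inter> S) = f F"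
  shows "mobius f D = 0"
proof -
  obtain a where a: "a \<in> D" "a \<notin> S" using assms(2) by auto
  have "f (insert a F) = f F" if "F \<subseteq> D - {a}" for F
  proof -
    have "insert a F \<inter> S = F \<inter> S" using a by auto
    then show ?thesis
      using assms(3)[of "insert a F"] assms(3)[of F] that a
      by (metis Diff_subset insert_subset subset_trans)
  qed
  then have "mobius (\<lambda>F. f (insert a F)) (D - {a}) = mobius f (D - {a})"
    by (rule mobius_cong)
  then show ?thesis
    using mobius_insert[of "D - {a}" a f] assms(1) a by (simp add: insert_absorb)
qed

text \<open>Inversion. Adding the transforms at \<open>D\<close> and \<open>insert a D\<close>
  replaces \<open>f\<close> by its shift along \<open>a\<close>, hence the induction with
  \<open>f\<close> arbitrary.\<close>

lemma sum_mobius: "finite G \<Longrightarrow> (\<Sum>D\<in>Pow G. mobius f D) = f G"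
proof (induction G arbitrary: f rule: finite_induct)
  case (insert a G)
  have "(\<Sum>D\<in>Pow (insert a G). mobius f D) = (\<Sum>D\<in>Pow G. mobius (\<lambda>F. f (insert a F)) D)"
    unfolding sum_Pow_insert[OF insert.hyps]
  proof (rule sum.cong[OF refl])
    fix D assume "D \<in> Pow G"
    then have "finite D" "a \<notin> D" using insert.hyps finite_subset by auto
    then show "mobius f D + mobius f (insert a D) = mobius (\<lambda>F. f (insert a F)) D"
      by (simp add: mobius_insert)
  qed
  then show ?case by (simp add: insert.IH)
qed simp

text \<open>Signs multiply over disjoint sets. In (a) this separates the residual part from the
  separator part.\<close>

lemma mobius_Un:
  assumes "finite A" "finite B" "A \<inter> B = {}"
  shows "mobius f (A \<union> B) = mobius (\<lambda>F. mobius (\<lambda>G. f (F \<union> G)) B) A"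
  using assms
proof (induction A arbitrary: f rule: finite_induct)
  case (insert a A)
  then have "a \<notin> A \<union> B" "finite (A \<union> B)" "A \<inter> B = {}" by auto
  with insert show ?case by (simp add: mobius_insert)
qed simp

text \<open>Inversion in the block \<open>F\<close> only, with the block \<open>D\<close> left
  transformed; this is the mechanism of the second form of (a).\<close>

lemma sum_mobius_Un:
  assumes "finite F" "finite D" "F \<inter> D = {}"
  shows "(\<Sum>H\<in>Pow F. mobius f (H \<union> D)) = mobius (\<lambda>G. f (F \<union> G)) D"
proof -
  have "(\<Sum>H\<in>Pow F. mobius f (H \<union> D))
      = (\<Sum>H\<in>Pow F. mobius (\<lambda>F. mobius (\<lambda>G. f (F \<union> G)) D) H)"
    using assms by (intro sum.cong mobius_Un) (auto intro: finite_subset)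
  then show ?thesis using sum_mobius[OF assms(1)] by simp
qed

lemma ln_powi_sign: "(x::real) > 0 \<Longrightarrow> ln (x powi ((- 1) ^ n)) = (- 1) ^ n * ln x"
  by (cases "even n") (simp_all add: power_int_minus ln_inverse[of x])

text \<open>Positivity of every factor lets the logarithm pass through the product, each exponent 1
  or -1 becoming a sign.\<close>

lemma interaction_eq_mobius:
  assumes "finite D" "\<And>F. F \<subseteq> D \<Longrightarrow> q (merge F (A - F) (i, istar)) > 0"
  shows "interaction istar q A D i = mobius (\<lambda>F. ln (q (merge F (A - F) (i, istar)))) D"
proof -
  have "interaction istar q A D i
      = (\<Sum>F\<in>Pow D. ln (q (merge F (A - F) (i, istar)) powi ((- 1) ^ card (D - F))))"
    unfolding interaction_def
    using assms by (intro ln_prod) (auto simp: power_int_eq_0_iff less_le dest: zero_less_power_int)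
  also have "\<dots> = mobius (\<lambda>F. ln (q (merge F (A - F) (i, istar)))) D"
    unfolding mobius_def using assms(2) by (intro sum.cong) (auto simp: ln_powi_sign)
  finally show ?thesis .
qed

section \<open>Marginals\<close>

lemma restrict_in_PiE: "x \<in> PiE A lev \<Longrightarrow> B \<subseteq> A \<Longrightarrow> restrict x B \<in> PiE B lev"
  by (auto simp: PiE_iff)

lemma restrict_eq_PiE: "x \<in> PiE A lev \<Longrightarrow> restrict x A = x"
  by (rule PiE_restrict)

text \<open>Extensions of \<open>a\<close> to \<open>A \<union> B\<close> are in bijection with the
  cells of \<open>B\<close> agreeing with \<open>a\<close> on the overlap: restrict to
  \<open>B\<close>, and glue back with \<open>merge\<close>.\<close>

lemma sum_restrict_Un:
  fixes h :: "('v \<Rightarrow> 'a) \<Rightarrow> real"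
  assumes "a \<in> PiE A lev"
  shows "(\<Sum>z\<in>{z\<in>PiE (A \<union> B) lev. restrict z A = a}. h (restrict z B))
       = (\<Sum>b\<in>{b\<in>PiE B lev. restrict b (A \<inter> B) = restrict a (A \<inter> B)}. h b)"
proof (rule sum.reindex_bij_witness[where i = "\<lambda>b. merge A B (a, b)" and j = "\<lambda>z. restrict z B"])
  fix z assume z: "z \<in> {z\<in>PiE (A \<union> B) lev. restrict z A = a}"
  show "merge A B (a, restrict z B) = z"
  proof -
    have "a v = z v" if "v \<in> A" for v
      using z that by auto
    moreover have "z \<in> extensional (A \<union> B)"
      using z by (simp add: PiE_iff)
    ultimately show ?thesis
      by (simp add: merge_def extensional_def fun_eq_iff)
  qed
  show "restrict z B \<in> {b\<in>PiE B lev. restrict b (A \<inter> B) = restrict a (A \<inter> B)}"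
    using z by (auto simp: PiE_iff Int_ac)
next
  fix b assume b: "b \<in> {b\<in>PiE B lev. restrict b (A \<inter> B) = restrict a (A \<inter> B)}"
  have ab: "a v = b v" if "v \<in> A" "v \<in> B" for v
    using b that by (auto simp: fun_eq_iff dest!: spec[where x = v])
  show "restrict (merge A B (a, b)) B = b"
    using b ab by (auto simp: merge_def PiE_iff extensional_def fun_eq_iff)
  show "merge A B (a, b) \<in> {z\<in>PiE (A \<union> B) lev. restrict z A = a}"
    using b assms by (auto simp: merge_def PiE_iff extensional_def fun_eq_iff)
qed simp

text \<open>Group the cells of \<open>V\<close> by their restriction to \<open>A\<close>.\<close>

lemma marginal_marginal:
  assumes "D \<subseteq> A" "A \<subseteq> V" "finite (PiE V lev)" "finite (PiE A lev)"
  shows "marginal A lev (marginal V lev p A) D x = marginal V lev p D x"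
proof -
  have "(\<Sum>z\<in>{z\<in>PiE A lev. restrict z D = x}.
           sum p {j \<in> {j\<in>PiE V lev. restrict j D = x}. restrict j A = z})
      = sum p {j\<in>PiE V lev. restrict j D = x}"
    using assms by (intro sum.group) (auto simp: restrict_in_PiE inf.absorb2)
  moreover have "{j \<in> {j\<in>PiE V lev. restrict j D = x}. restrict j A = z}
      = {j\<in>PiE V lev. restrict j A = z}" if "restrict z D = x" for z
    using that assms(1) by (auto simp: inf.absorb2)
  ultimately show ?thesis
    by (simp add: marginal_def)
qed

section \<open>Log marginals at cells and their Moebius transforms\<close>

locale loglinear =
  fixes V :: "'v set" and lev :: "'v \<Rightarrow> 'a set" and istar :: "'v \<Rightarrow> 'a"
    and p :: "('v \<Rightarrow> 'a) \<Rightarrow> real"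
  assumes finite_V: "finite V" and finite_lev: "\<And>\<gamma>. \<gamma> \<in> V \<Longrightarrow> finite (lev \<gamma>)"
    and istar: "\<And>\<gamma>. \<gamma> \<in> V \<Longrightarrow> istar \<gamma> \<in> lev \<gamma>" and pos_prob: "pos_prob V lev p"
begin

abbreviation mg :: "'v set \<Rightarrow> ('v \<Rightarrow> 'a) \<Rightarrow> real" where
  "mg \<equiv> marginal V lev p"

text \<open>\<open>F\<close> need not be a subset of \<open>A\<close>; this makes \<open>cell i A F\<close> depend on \<open>F \<inter> A\<close> only.\<close>

abbreviation cell :: "('v \<Rightarrow> 'a) \<Rightarrow> 'v set \<Rightarrow> 'v set \<Rightarrow> 'v \<Rightarrow> 'a" where
  "cell i A F \<equiv> merge (F \<inter> A) (A - F) (i, istar)"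

text \<open>\<open>F\<close> comes last so that \<open>lm i A\<close> is itself the set function to
  be transformed; \<open>i\<close> may be any function, since only its values on
  \<open>F \<inter> A\<close> are read.\<close>

definition lm :: "('v \<Rightarrow> 'a) \<Rightarrow> 'v set \<Rightarrow> 'v set \<Rightarrow> real" where
  "lm i A F = ln (mg A (cell i A F))"

lemma finite_PiE_lev: "A \<subseteq> V \<Longrightarrow> finite (PiE A lev)"
  using finite_V finite_lev by (intro finite_PiE) (auto intro: finite_subset)

lemma cell_in_PiE: "A \<subseteq> V \<Longrightarrow> i \<in> Pi F lev \<Longrightarrow> cell i A F \<in> PiE A lev"
  using istar by (auto simp: merge_def PiE_iff extensional_def)

lemma restrict_cell: "B \<subseteq> A \<Longrightarrow> restrict (cell i A F) B = cell i B F"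
  by (auto simp: merge_def fun_eq_iff)

lemma marginal_V: "x \<in> PiE V lev \<Longrightarrow> mg V x = p x"
proof -
  assume x: "x \<in> PiE V lev"
  then have "{j \<in> PiE V lev. restrict j V = x} = {x}"
    by (auto simp: restrict_eq_PiE)
  then show ?thesis by (simp add: marginal_def)
qed

text \<open>The only cell on the empty set is the undefined function, and it carries the total mass.
  This starts the induction in \<open>lm_hist\<close>.\<close>

lemma marginal_empty: "mg {} x = (if x = (\<lambda>_. undefined) then 1 else 0)"
proof -
  have "restrict j {} = (\<lambda>_. undefined)" for j :: "'v \<Rightarrow> 'a"
    by auto
  then show ?thesis
    using pos_prob by (auto simp: marginal_def pos_prob_def)
qed

lemma marginal_pos:
  assumes "A \<subseteq> V" "x \<in> PiE A lev"
  shows "mg A x > 0"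
  unfolding marginal_def
proof (rule sum_pos)
  show "finite {j \<in> PiE V lev. restrict j A = x}"
    using finite_PiE_lev[of V] by simp
  \<comment> \<open>The fibre is nonempty: extend \<open>x\<close> by \<open>istar\<close>.\<close>
  have "merge A (V - A) (x, istar) \<in> {j \<in> PiE V lev. restrict j A = x}"
    using assms istar by (auto simp: merge_def PiE_iff extensional_def fun_eq_iff)
  then show "{j \<in> PiE V lev. restrict j A = x} \<noteq> {}" by blast
qed (use pos_prob in \<open>auto simp: pos_prob_def\<close>)

lemma marginal_tower:
  "D \<subseteq> A \<Longrightarrow> A \<subseteq> V \<Longrightarrow> mg D x = (\<Sum>z\<in>{z\<in>PiE A lev. restrict z D = x}. mg A z)"
  using marginal_marginal[of D A V lev p x] by (simp add: finite_PiE_lev marginal_def[of A])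

lemma marginal_cell_pos: "A \<subseteq> V \<Longrightarrow> i \<in> Pi F lev \<Longrightarrow> mg A (cell i A F) > 0"
  by (intro marginal_pos cell_in_PiE)

lemma lm_cong:
  assumes "\<And>\<gamma>. \<gamma> \<in> F \<Longrightarrow> i \<gamma> = i' \<gamma>"
  shows "lm i A F = lm i' A F"
proof -
  have "cell i A F = cell i' A F"
    using assms by (auto simp: merge_def fun_eq_iff)
  then show ?thesis by (simp add: lm_def)
qed

lemma mobius_lm_cong: "(\<And>\<gamma>. \<gamma> \<in> D \<Longrightarrow> i \<gamma> = i' \<gamma>) \<Longrightarrow> mobius (lm i A) D = mobius (lm i' A) D"
  by (intro mobius_cong lm_cong) auto

lemma lm_Int: "lm i A (F \<inter> A) = lm i A F"
proof -
  have "A - F \<inter> A = A - F" "F \<inter> A \<inter> A = F \<inter> A" by auto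
  then show ?thesis by (simp add: lm_def)
qed

text \<open>Case \<open>S = A\<close> of the vanishing criterion, as \<open>lm i A\<close> reads
  only \<open>F \<inter> A\<close>. Marginals on sets not containing \<open>D\<close> thereby drop
  out of the identities below.\<close>

lemma mobius_lm_eq_0: "finite D \<Longrightarrow> \<not> D \<subseteq> A \<Longrightarrow> mobius (lm i A) D = 0"
  by (rule mobius_eq_0[of D A]) (auto simp: lm_Int)

lemma theta_marg_eq:
  assumes "A \<subseteq> V" "D \<subseteq> A" "i \<in> Pi D lev"
  shows "theta_marg V lev istar p A D i = mobius (lm i A) D"
proof -
  have *: "merge F (A - F) (i, istar) = cell i A F" if "F \<subseteq> D" for F
    using that assms by (simp add: inf.absorb1)
  have "finite D"
    using assms(1,2) finite_V by (meson finite_subset)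
  moreover have "mg A (merge F (A - F) (i, istar)) > 0" if "F \<subseteq> D" for F
    unfolding *[OF that] using assms that by (intro marginal_cell_pos) auto
  ultimately have "theta_marg V lev istar p A D i
      = mobius (\<lambda>F. ln (mg A (merge F (A - F) (i, istar)))) D"
    unfolding theta_marg_def by (rule interaction_eq_mobius)
  also have "\<dots> = mobius (lm i A) D"
    by (rule mobius_cong) (simp add: lm_def *)
  finally show ?thesis .
qed

text \<open>Only cells of \<open>V\<close> are evaluated, and there \<open>p\<close> is its own
  marginal; so a joint interaction is the case \<open>A = V\<close> of a marginal one.\<close>

lemma theta_eq:
  assumes "D \<subseteq> V" "i \<in> Pi D lev"
  shows "theta V istar p D i = mobius (lm i V) D"
proof -
  have "merge F (V - F) (i, istar) \<in> PiE V lev" if "F \<subseteq> D" for F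
    using assms that istar by (auto simp: merge_def PiE_iff extensional_def)
  then have "interaction istar p V D i = interaction istar (mg V) V D i"
    unfolding interaction_def
    by (intro arg_cong[where f = ln] prod.cong) (auto simp: marginal_V)
  then show ?thesis
    using theta_marg_eq[of V D i] assms by (simp add: theta_def theta_marg_def)
qed

section \<open>Marginals of a product of two factors\<close>

text \<open>Let \<open>F\<close>, \<open>G\<close> be the sums of \<open>f\<close>, \<open>g\<close>
  over the coordinates outside \<open>A \<inter> B\<close>. The marginals on \<open>A\<close>,
  \<open>B\<close> and \<open>A \<inter> B\<close> are then \<open>f G\<close>, \<open>F g\<close>
  and \<open>F G\<close>, so both sides equal \<open>f g F G\<close>.\<close>

lemma marginal_factor:
  assumes W: "A \<union> B \<subseteq> V"
    and fg: "\<And>z. z \<in> PiE (A \<union> B) lev \<Longrightarrow> mg (A \<union> B) z = f (restrict z A) * g (restrict z B)"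
    and x: "x \<in> PiE (A \<union> B) lev"
  shows "mg (A \<union> B) x * mg (A \<inter> B) (restrict x (A \<inter> B))
       = mg A (restrict x A) * mg B (restrict x B)"
proof -
  define G where "G s = (\<Sum>b\<in>{b\<in>PiE B lev. restrict b (A \<inter> B) = s}. g b)" for s
  define F where "F s = (\<Sum>a\<in>{a\<in>PiE A lev. restrict a (A \<inter> B) = s}. f a)" for s
  have A: "mg A a = f a * G (restrict a (A \<inter> B))" if "a \<in> PiE A lev" for a
  proof -
    have "mg A a = (\<Sum>z\<in>{z\<in>PiE (A \<union> B) lev. restrict z A = a}. f a * g (restrict z B))"
      using marginal_tower[of A "A \<union> B"] W by (auto simp: fg intro!: sum.cong)
    also have "\<dots> = f a * G (restrict a (A \<inter> B))"
      using that by (simp add: sum_distrib_left[symmetric] sum_restrict_Un G_def)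
    finally show ?thesis .
  qed
  have B: "mg B b = F (restrict b (A \<inter> B)) * g b" if "b \<in> PiE B lev" for b
  proof -
    have "mg B b = (\<Sum>z\<in>{z\<in>PiE (A \<union> B) lev. restrict z B = b}. f (restrict z A) * g b)"
      using marginal_tower[of B "A \<union> B"] W by (auto simp: fg intro!: sum.cong)
    also have "\<dots> = F (restrict b (A \<inter> B)) * g b"
      using that sum_restrict_Un[of b B lev f A]
      by (simp add: sum_distrib_right[symmetric] F_def Un_commute Int_commute)
    finally show ?thesis .
  qed
  have "mg (A \<inter> B) s = F s * G s" for s
  proof -
    have "mg (A \<inter> B) s = (\<Sum>a\<in>{a\<in>PiE A lev. restrict a (A \<inter> B) = s}. f a * G s)"
      using marginal_tower[of "A \<inter> B" A] W by (auto simp: A intro!: sum.cong)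
    then show ?thesis by (simp add: F_def sum_distrib_right)
  qed
  moreover have "restrict x A \<in> PiE A lev" "restrict x B \<in> PiE B lev"
    using x by (auto intro: restrict_in_PiE)
  ultimately show ?thesis
    using x by (simp add: A B fg inf.absorb2)
qed

lemma lm_factor:
  assumes "A \<union> B \<subseteq> V"
    and "\<And>z. z \<in> PiE (A \<union> B) lev \<Longrightarrow> mg (A \<union> B) z = f (restrict z A) * g (restrict z B)"
    and "i \<in> Pi F lev"
  shows "lm i (A \<union> B) F + lm i (A \<inter> B) F = lm i A F + lm i B F"
proof -
  have "mg (A \<union> B) (cell i (A \<union> B) F) * mg (A \<inter> B) (cell i (A \<inter> B) F)
      = mg A (cell i A F) * mg B (cell i B F)"
    using marginal_factor[OF assms(1,2) cell_in_PiE[OF assms(1,3)]]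
    by (simp add: restrict_cell le_infI1)
  moreover have "mg X (cell i X F) > 0" if "X \<subseteq> V" for X
    using that assms(3) by (rule marginal_cell_pos)
  ultimately show ?thesis
    using assms(1) unfolding lm_def
    by (subst (1 2) ln_mult_pos[symmetric]) (auto simp: le_infI1)
qed

section \<open>Marginals up to a constant factor\<close>

text \<open>The constant \<open>ln c\<close> is killed by the transform because \<open>D\<close> is
  nonempty.\<close>

lemma mobius_lm_scaled:
  assumes "A \<subseteq> V" "D \<noteq> {}" "finite D" "i \<in> Pi D lev" "loglinear V lev istar q" "c > 0"
    and "\<And>x. x \<in> PiE A lev \<Longrightarrow> mg A x = c * marginal V lev q A x"
  shows "mobius (lm i A) D = mobius (loglinear.lm V lev istar q i A) D"
proof -
  interpret q: loglinear V lev istar q by fact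
  have "lm i A F = ln c + q.lm i A F" if "F \<subseteq> D" for F
  proof -
    have "i \<in> Pi F lev" using assms(4) that by auto
    then show ?thesis
      using assms(1,6,7) cell_in_PiE[of A i F] q.marginal_cell_pos[of A i F]
      by (simp add: lm_def q.lm_def ln_mult_pos)
  qed
  then have "mobius (lm i A) D = mobius (\<lambda>F. ln c + q.lm i A F) D"
    by (rule mobius_cong)
  also have "\<dots> = mobius (q.lm i A) D"
    using mobius_eq_0[OF assms(3), of "{}" "\<lambda>F. ln c"] assms(2) by (simp add: mobius_add)
  finally show ?thesis .
qed

text \<open>The interactions of positive degree determine a marginal up to a constant factor, which
  cancels from the interactions of every smaller marginal.\<close>

lemma marginal_determined:
  assumes "A \<subseteq> V" "loglinear V lev istar q"
    and eq: "\<And>B y. B \<noteq> {} \<Longrightarrow> B \<subseteq> A \<Longrightarrow> y \<in> nz_cells lev istar B \<Longrightarrow>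
      theta_marg V lev istar p A B y = theta_marg V lev istar q A B y"
  shows "\<exists>c>0. \<forall>x\<in>PiE A lev. mg A x = c * marginal V lev q A x"
proof -
  interpret q: loglinear V lev istar q by fact
  have main: "ln (mg A x) = (lm istar A {} - q.lm istar A {}) + ln (marginal V lev q A x)"
    if x: "x \<in> PiE A lev" for x
  proof -
    \<comment> \<open>\<open>L\<close> collects the coordinates where \<open>x\<close> leaves
      \<open>istar\<close>, so the restriction of \<open>x\<close> to any nonempty
      \<open>B \<subseteq> L\<close> is a cell to which \<open>eq\<close> applies.\<close>
    define L where "L = {\<gamma>\<in>A. x \<gamma> \<noteq> istar \<gamma>}"
    have L: "L \<subseteq> A" "finite L"
      using assms(1) finite_V by (auto simp: L_def intro: finite_subset)
    have cell: "cell x A L = x"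
      using x by (auto simp: merge_def fun_eq_iff L_def PiE_iff extensional_def)
    have B: "mobius (lm x A) B = mobius (q.lm x A) B" if "B \<subseteq> L" "B \<noteq> {}" for B
    proof -
      have y: "restrict x B \<in> nz_cells lev istar B" "x \<in> Pi B lev"
        using that x by (auto simp: nz_cells_def L_def)
      then have "restrict x B \<in> Pi B lev" by auto
      then show ?thesis
        using eq[of B "restrict x B"] that y L(1) assms(1)
        by (simp add: theta_marg_eq q.theta_marg_eq
            mobius_lm_cong[of B x "restrict x B"] q.mobius_lm_cong[of B x "restrict x B"])
    qed
    \<comment> \<open>By inversion the two log marginals differ only through the term
      \<open>B = {}\<close>, which does not see \<open>x\<close> and yields
      \<open>c\<close>.\<close>
    have "lm x A L - q.lm x A L = (\<Sum>B\<in>Pow L. mobius (lm x A) B - mobius (q.lm x A) B)"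
      using L by (simp add: sum_subtractf sum_mobius)
    also have "\<dots> = (\<Sum>B\<in>{{}}. mobius (lm x A) B - mobius (q.lm x A) B)"
      using L B by (intro sum.mono_neutral_right) auto
    also have "\<dots> = lm istar A {} - q.lm istar A {}"
      using lm_cong[of "{}" x istar A] q.lm_cong[of "{}" x istar A] by simp
    finally show ?thesis
      by (simp add: lm_def q.lm_def cell)
  qed
  define c where "c = exp (lm istar A {} - q.lm istar A {})"
  have "mg A x = c * marginal V lev q A x" if "x \<in> PiE A lev" for x
  proof -
    have "exp (ln (mg A x)) = c * exp (ln (marginal V lev q A x))"
      unfolding c_def exp_add[symmetric] main[OF that] ..
    then show ?thesis
      using that assms(1) marginal_pos q.marginal_pos by simp
  qed
  then show ?thesis
    by (intro exI[of _ c]) (simp add: c_def)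
qed

lemma marginal_scaled_subset:
  assumes "S \<subseteq> A" "A \<subseteq> V" "loglinear V lev istar q"
    and "\<And>x. x \<in> PiE A lev \<Longrightarrow> mg A x = c * marginal V lev q A x"
  shows "mg S x = c * marginal V lev q S x"
proof -
  interpret q: loglinear V lev istar q by fact
  show ?thesis
    unfolding marginal_tower[OF assms(1,2)] q.marginal_tower[OF assms(1,2)] sum_distrib_left
    using assms(4) by (intro sum.cong) auto
qed

section \<open>Log-linear expansion and summing out coordinates\<close>

lemma ln_eq_sum_mobius:
  assumes "x \<in> PiE V lev"
  shows "ln (p x) = (\<Sum>D\<in>Pow V. mobius (lm x V) D)"
proof -
  have "cell x V V = x"
    using assms by (auto simp: merge_def fun_eq_iff PiE_iff extensional_def)
  then show ?thesis
    using assms by (simp add: sum_mobius finite_V lm_def marginal_V)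
qed

text \<open>A cell agreeing with \<open>(i\<^sub>F, istar)\<close> off \<open>B\<close> is given by
  the set \<open>L\<close> where it differs from \<open>istar\<close> on \<open>B\<close> and by its
  values \<open>j\<close> there. In the expansion of its log probability, the subsets of
  \<open>F\<close> add up to \<open>lm i V F\<close> and the others to the exponent in
  \<open>k_fun\<close>. Exponentiating and summing over \<open>(L, j)\<close> gives the marginal on
  \<open>V - B\<close>.\<close>

lemma lm_add_k_fun:
  assumes "B \<subseteq> V" "F \<subseteq> V - B" "i \<in> Pi F lev"
  shows "lm i V F + k_fun V lev istar p B F i = lm i (V - B) F"
proof -
  have fin: "finite F" "finite B"
    using assms(1,2) finite_V by (meson finite_subset Diff_subset)+
  define c where "c = cell i (V - B) F"
  define \<theta> where "\<theta> L j = (\<Sum>K\<in>Pow F. \<Sum>M\<in>Pow L - {{}}. theta V istar p (K \<union> M) (merge K M (i, j)))"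
    for L j
  have p: "p (cell (merge F L (i, j)) V (F \<union> L)) = exp (lm i V F + \<theta> L j)"
    if L: "L \<subseteq> B" and j: "j \<in> nz_cells lev istar L" for L j
  proof -
    define x where "x = merge F L (i, j)"
    have FL: "F \<inter> L = {}" "finite L" "L \<subseteq> V"
      using assms(1,2) L fin by (auto intro: finite_subset)
    have x: "x \<in> Pi (F \<union> L) lev"
      using assms(3) j FL by (auto simp: x_def merge_def nz_cells_def)
    have Int: "D \<inter> F \<union> D \<inter> L = D" if "D \<subseteq> F \<union> L" for D
      using that by auto
    have "lm x V (F \<union> L) = (\<Sum>D\<in>Pow (F \<union> L). mobius (lm x V) D)"
      using fin FL by (simp add: sum_mobius)
    \<comment> \<open>Split \<open>D\<close> into its parts in the disjoint sets \<open>F\<close>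
      and \<open>L\<close>.\<close>
    also have "\<dots> = (\<Sum>(K, M)\<in>Pow F \<times> Pow L. mobius (lm x V) (K \<union> M))"
      using FL by (intro sum.reindex_bij_witness[where i = "\<lambda>(K, M). K \<union> M"
            and j = "\<lambda>D. (D \<inter> F, D \<inter> L)"]) (auto simp: Int)
    also have "\<dots> = (\<Sum>K\<in>Pow F. \<Sum>M\<in>Pow L. mobius (lm x V) (K \<union> M))"
      by (simp add: sum.cartesian_product)
    also have "\<dots> = (\<Sum>K\<in>Pow F. mobius (lm x V) K + (\<Sum>M\<in>Pow L - {{}}. mobius (lm x V) (K \<union> M)))"
      using FL by (intro sum.cong refl) (simp add: sum.remove[of _ "{}"])
    also have "\<dots> = lm x V F + (\<Sum>K\<in>Pow F. \<Sum>M\<in>Pow L - {{}}. mobius (lm x V) (K \<union> M))"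
      using fin by (simp add: sum.distrib sum_mobius)
    also have "lm x V F = lm i V F"
      by (rule lm_cong) (simp add: x_def merge_def)
    also have "(\<Sum>K\<in>Pow F. \<Sum>M\<in>Pow L - {{}}. mobius (lm x V) (K \<union> M)) = \<theta> L j"
      unfolding \<theta>_def
    proof (intro sum.cong refl)
      fix K M assume "K \<in> Pow F" "M \<in> Pow L - {{}}"
      then have KM: "K \<subseteq> F" "M \<subseteq> L" by auto
      have *: "merge K M (i, j) \<gamma> = x \<gamma>" if "\<gamma> \<in> K \<union> M" for \<gamma>
        using that KM FL by (auto simp: x_def merge_def)
      have "merge K M (i, j) \<in> Pi (K \<union> M) lev"
        using x KM by (auto simp: *)
      moreover have "K \<union> M \<subseteq> V" using KM FL assms(2) by auto
      ultimately show "mobius (lm x V) (K \<union> M) = theta V istar p (K \<union> M) (merge K M (i, j))"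
        using mobius_lm_cong[of "K \<union> M" "merge K M (i, j)" x, OF *] by (simp add: theta_eq)
    qed
    finally have "ln (p (cell x V (F \<union> L))) = lm i V F + \<theta> L j"
      using x by (simp add: lm_def marginal_V cell_in_PiE)
    moreover have "p (cell x V (F \<union> L)) > 0"
      using marginal_cell_pos[of V x "F \<union> L"] x by (simp add: marginal_V cell_in_PiE)
    ultimately show ?thesis
      unfolding x_def by (metis exp_ln)
  qed
  \<comment> \<open>The pair \<open>(L, j)\<close> is recovered from its cell because
    \<open>j\<close> avoids \<open>istar\<close> on all of \<open>L\<close>.\<close>
  have "mg (V - B) c = (\<Sum>(L, j)\<in>Sigma (Pow B) (nz_cells lev istar). exp (lm i V F + \<theta> L j))"
    unfolding marginal_def
  proof (rule sum.reindex_bij_witness[where i = "\<lambda>(L, j). cell (merge F L (i, j)) V (F \<union> L)"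
        and j = "\<lambda>z. ({\<gamma>\<in>B. z \<gamma> \<noteq> istar \<gamma>}, restrict z {\<gamma>\<in>B. z \<gamma> \<noteq> istar \<gamma>})"])
    fix z assume z: "z \<in> {z \<in> PiE V lev. restrict z (V - B) = c}"
    let ?L = "{\<gamma>\<in>B. z \<gamma> \<noteq> istar \<gamma>}"
    have zc: "z \<gamma> = (if \<gamma> \<in> F then i \<gamma> else istar \<gamma>)" if "\<gamma> \<in> V - B" for \<gamma>
    proof -
      have "z \<gamma> = c \<gamma>" using z that by auto
      then show ?thesis using that by (auto simp: c_def merge_def)
    qed
    have "cell (merge F ?L (i, restrict z ?L)) V (F \<union> ?L) \<gamma> = z \<gamma>" for \<gamma>
      using zc[of \<gamma>] assms(1,2) z by (auto simp: merge_def PiE_iff extensional_def)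
    then show inv: "(case (?L, restrict z ?L) of (L, j) \<Rightarrow> cell (merge F L (i, j)) V (F \<union> L)) = z"
      by (simp add: fun_eq_iff)
    have j: "restrict z ?L \<in> nz_cells lev istar ?L"
      using z assms(1) by (auto simp: nz_cells_def PiE_iff)
    then show "(?L, restrict z ?L) \<in> Sigma (Pow B) (nz_cells lev istar)"
      by auto
    show "(case (?L, restrict z ?L) of (L, j) \<Rightarrow> exp (lm i V F + \<theta> L j)) = p z"
      using p[OF _ j] inv by auto
  next
    fix Lj assume "Lj \<in> Sigma (Pow B) (nz_cells lev istar)"
    then obtain L j where Lj: "Lj = (L, j)" "L \<subseteq> B" "j \<in> nz_cells lev istar L" by auto
    define z where "z = cell (merge F L (i, j)) V (F \<union> L)"
    have FL: "F \<inter> L = {}" "L \<subseteq> V" using Lj assms by auto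
    have zV: "z \<in> PiE V lev"
      unfolding z_def using Lj(3) FL assms(3)
      by (intro cell_in_PiE) (auto simp: merge_def nz_cells_def)
    have zL: "z \<gamma> = (if \<gamma> \<in> L then j \<gamma> else istar \<gamma>)" if "\<gamma> \<in> B" for \<gamma>
      using that assms(1,2) Lj by (auto simp: z_def merge_def)
    have "j \<gamma> \<noteq> istar \<gamma>" if "\<gamma> \<in> L" for \<gamma>
      using Lj(3) that by (auto simp: nz_cells_def PiE_iff)
    then have L: "{\<gamma>\<in>B. z \<gamma> \<noteq> istar \<gamma>} = L"
      using Lj(2) zL by (auto split: if_splits)
    have "restrict z L = j"
      using Lj(2,3) zL by (auto simp: nz_cells_def PiE_iff extensional_def fun_eq_iff)
    with L show "({\<gamma>\<in>B. (case Lj of (L, j) \<Rightarrow> cell (merge F L (i, j)) V (F \<union> L)) \<gamma> \<noteq> istar \<gamma>},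
        restrict (case Lj of (L, j) \<Rightarrow> cell (merge F L (i, j)) V (F \<union> L))
          {\<gamma>\<in>B. (case Lj of (L, j) \<Rightarrow> cell (merge F L (i, j)) V (F \<union> L)) \<gamma> \<noteq> istar \<gamma>}) = Lj"
      unfolding Lj(1) prod.case z_def[symmetric] by simp
    have "restrict z (V - B) = c"
      using Lj(2) FL assms(1,2) by (auto simp: z_def c_def merge_def fun_eq_iff)
    then show "(case Lj of (L, j) \<Rightarrow> cell (merge F L (i, j)) V (F \<union> L))
        \<in> {z \<in> PiE V lev. restrict z (V - B) = c}"
      using zV by (simp add: Lj(1) z_def)
  qed
  also have "\<dots> = exp (lm i V F) * (\<Sum>L\<in>Pow B. \<Sum>j\<in>nz_cells lev istar L. exp (\<theta> L j))"
  proof -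
    have "finite (nz_cells lev istar L)" if "L \<in> Pow B" for L
      using that fin(2) finite_lev assms(1) unfolding nz_cells_def
      by (intro finite_PiE) (auto intro: finite_subset)
    then show ?thesis
      using fin(2) by (simp add: sum.Sigma[symmetric] exp_add sum_distrib_left)
  qed
  \<comment> \<open>\<open>L = {}\<close> has a single cell and an empty exponent; it supplies the 1
    in \<open>k_fun\<close>.\<close>
  also have "(\<Sum>L\<in>Pow B. \<Sum>j\<in>nz_cells lev istar L. exp (\<theta> L j))
      = 1 + (\<Sum>L\<in>Pow B - {{}}. \<Sum>j\<in>nz_cells lev istar L. exp (\<theta> L j))"
    using fin(2) by (simp add: sum.remove[of _ "{}"] nz_cells_def \<theta>_def)
  finally have "mg (V - B) c
      = exp (lm i V F) * (1 + (\<Sum>L\<in>Pow B - {{}}. \<Sum>j\<in>nz_cells lev istar L. exp (\<theta> L j)))" .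
  moreover have "1 + (\<Sum>L\<in>Pow B - {{}}. \<Sum>j\<in>nz_cells lev istar L. exp (\<theta> L j)) > 0"
    by (intro add_pos_nonneg sum_nonneg) auto
  ultimately show ?thesis
    by (simp add: lm_def[of i "V - B"] c_def[symmetric] ln_mult_pos k_fun_def \<theta>_def)
qed

text \<open>Transform of \<open>lm_add_k_fun\<close> over \<open>F\<close>; for
  \<open>B = C_later C k l\<close> it produces the correction term of (b)(ii).\<close>

lemma mobius_lm_Diff:
  assumes "B \<subseteq> V" "D \<subseteq> V - B" "i \<in> Pi D lev"
  shows "mobius (lm i (V - B)) D
       = theta V istar p D i + mobius (\<lambda>F. k_fun V lev istar p B F i) D"
proof -
  have "mobius (lm i (V - B)) D = mobius (\<lambda>F. lm i V F + k_fun V lev istar p B F i) D"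
  proof (rule mobius_cong)
    fix F assume "F \<subseteq> D"
    then have "F \<subseteq> V - B" "i \<in> Pi F lev" using assms by auto
    then show "lm i (V - B) F = lm i V F + k_fun V lev istar p B F i"
      using lm_add_k_fun[of B F i] assms(1) by simp
  qed
  moreover have "D \<subseteq> V" using assms by auto
  ultimately show ?thesis
    using assms(3) by (simp add: mobius_add theta_eq)
qed

section \<open>Conditional interactions and part (a)\<close>

text \<open>The denominator, a marginal on \<open>S\<close>, does not vary with \<open>G\<close> and
  drops out for nonempty \<open>D\<close>. One function \<open>x\<close> carries both the separator
  part \<open>f\<close> and the residual part \<open>i\<close>, which come from the same cell in one
  use and from two cells in the other.\<close>

lemma theta_cond_eq:
  assumes RS: "R \<inter> S = {}" "R \<union> S \<subseteq> V" and F: "F \<subseteq> S" and D: "D \<subseteq> R" "D \<noteq> {}"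
    and x: "x \<in> Pi (F \<union> D) lev" "\<And>\<gamma>. \<gamma> \<in> F \<Longrightarrow> f \<gamma> = x \<gamma>" "\<And>\<gamma>. \<gamma> \<in> D \<Longrightarrow> i \<gamma> = x \<gamma>"
  shows "theta_cond V lev istar p R S (merge F (S - F) (f, istar)) D i
       = mobius (\<lambda>G. lm x (R \<union> S) (F \<union> G)) D"
proof -
  let ?s = "merge F (S - F) (f, istar)"
  have s: "?s = cell x S F"
    using F x(2) by (auto simp: merge_def fun_eq_iff)
  have s_pos: "mg S ?s > 0"
    unfolding s using RS x(1) by (intro marginal_cell_pos) auto
  have finD: "finite D"
    using D(1) RS(2) finite_V by (meson finite_subset le_sup_iff)
  have cond: "conditional V lev p R S ?s (merge G (R - G) (i, istar))
      = mg (R \<union> S) (cell x (R \<union> S) (F \<union> G)) / mg S ?s"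
    and pos: "mg (R \<union> S) (cell x (R \<union> S) (F \<union> G)) > 0" if G: "G \<subseteq> D" for G
  proof -
    have iG: "i \<gamma> = x \<gamma>" if "\<gamma> \<in> G" for \<gamma>
      using x(3) G that by auto
    have "merge R S (merge G (R - G) (i, istar), ?s) = cell x (R \<union> S) (F \<union> G)"
      using RS(1) F D(1) G x(2) iG by (auto simp: merge_def fun_eq_iff)
    then show "conditional V lev p R S ?s (merge G (R - G) (i, istar))
        = mg (R \<union> S) (cell x (R \<union> S) (F \<union> G)) / mg S ?s"
      by (simp add: conditional_def)
    show "mg (R \<union> S) (cell x (R \<union> S) (F \<union> G)) > 0"
      using RS(2) x(1) G by (intro marginal_cell_pos) auto
  qed
  have "theta_cond V lev istar p R S ?s D i
      = mobius (\<lambda>G. ln (conditional V lev p R S ?s (merge G (R - G) (i, istar)))) D"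
    unfolding theta_cond_def using finD cond pos s_pos by (intro interaction_eq_mobius) auto
  also have "\<dots> = mobius (\<lambda>G. lm x (R \<union> S) (F \<union> G) - ln (mg S ?s)) D"
    using cond pos s_pos by (intro mobius_cong) (simp add: lm_def ln_divide_pos)
  also have "\<dots> = mobius (\<lambda>G. lm x (R \<union> S) (F \<union> G)) D"
    using mobius_eq_0[OF finD, of "{}" "\<lambda>_. ln (mg S ?s)"] D(2) by (simp add: mobius_diff)
  finally show ?thesis .
qed

text \<open>Transform first over the part of \<open>D\<close> in \<open>R\<close>, then over the
  part in \<open>S\<close>; the inner transform is a conditional interaction.\<close>

lemma theta_marg_eq_sum_theta_cond:
  assumes "R \<inter> S = {}" "R \<union> S \<subseteq> V" "D \<subseteq> R \<union> S" "D \<inter> R \<noteq> {}" "i \<in> Pi D lev"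
  shows "theta_marg V lev istar p (R \<union> S) D i
       = (\<Sum>F\<in>Pow (D \<inter> S). (- 1) ^ card (D \<inter> S - F) *
           theta_cond V lev istar p R S (merge F (S - F) (i, istar)) (D \<inter> R) i)"
proof -
  have D: "D = (D \<inter> S) \<union> (D \<inter> R)" "finite D"
    using assms(2,3) finite_V by (auto intro: finite_subset)
  have "theta_marg V lev istar p (R \<union> S) D i = mobius (lm i (R \<union> S)) ((D \<inter> S) \<union> (D \<inter> R))"
    using theta_marg_eq[OF assms(2,3,5)] D by simp
  also have "\<dots> = mobius (\<lambda>F. mobius (\<lambda>G. lm i (R \<union> S) (F \<union> G)) (D \<inter> R)) (D \<inter> S)"
    using D(2) assms(1) by (intro mobius_Un) auto
  also have "\<dots> = mobius (\<lambda>F. theta_cond V lev istar p R S (merge F (S - F) (i, istar)) (D \<inter> R) i) (D \<inter> S)"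
    using assms by (intro mobius_cong theta_cond_eq[symmetric]) auto
  finally show ?thesis
    by (simp add: mobius_def)
qed

text \<open>Summing over \<open>H\<close> inverts the transform in the separator block alone,
  leaving that block fixed at \<open>F\<close>; by \<open>theta_cond_eq\<close> this is the
  conditional interaction.\<close>

lemma theta_cond_eq_sum_theta_marg:
  assumes RS: "R \<inter> S = {}" "R \<union> S \<subseteq> V" and D: "D \<subseteq> R" "D \<noteq> {}" and F: "F \<subseteq> S"
    and i: "i \<in> Pi D lev" and f: "f \<in> Pi F lev"
  shows "theta_cond V lev istar p R S (merge F (S - F) (f, istar)) D i
       = (\<Sum>H\<in>Pow F. theta_marg V lev istar p (R \<union> S) (H \<union> D) (merge H D (f, i)))"
proof -
  define x where "x = merge F D (f, i)"
  have FD: "F \<inter> D = {}" using assms by auto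
  have x: "x \<in> Pi (F \<union> D) lev"
    using i f FD by (auto simp: x_def merge_def)
  have "finite F" "finite D"
    using RS(2) F D(1) finite_V by (meson finite_subset le_sup_iff)+
  then have "mobius (\<lambda>G. lm x (R \<union> S) (F \<union> G)) D = (\<Sum>H\<in>Pow F. mobius (lm x (R \<union> S)) (H \<union> D))"
    using FD by (simp add: sum_mobius_Un)
  also have "\<dots> = (\<Sum>H\<in>Pow F. theta_marg V lev istar p (R \<union> S) (H \<union> D) (merge H D (f, i)))"
  proof (intro sum.cong refl)
    fix H assume H: "H \<in> Pow F"
    have *: "merge H D (f, i) \<gamma> = x \<gamma>" if "\<gamma> \<in> H \<union> D" for \<gamma>
      using that H FD by (auto simp: x_def merge_def)
    then have "merge H D (f, i) \<in> Pi (H \<union> D) lev"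
      using x H by auto
    moreover have "H \<union> D \<subseteq> R \<union> S" using H F D by auto
    ultimately show "mobius (lm x (R \<union> S)) (H \<union> D)
        = theta_marg V lev istar p (R \<union> S) (H \<union> D) (merge H D (f, i))"
      using mobius_lm_cong[of "H \<union> D" "merge H D (f, i)" x, OF *] RS(2) by (simp add: theta_marg_eq)
  qed
  moreover have "theta_cond V lev istar p R S (merge F (S - F) (f, istar)) D i
      = mobius (\<lambda>G. lm x (R \<union> S) (F \<union> G)) D"
    using FD by (intro theta_cond_eq RS F D x) (auto simp: x_def merge_def)
  ultimately show ?thesis by simp
qed

end

section \<open>Markov probabilities on decomposable graphs\<close>

lemma hist_0 [simp]: "hist C 0 = {}"
  by (simp add: hist_def)

lemma hist_Suc: "hist C (Suc n) = hist C n \<union> C (Suc n)"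
  by (auto simp: hist_def atLeastAtMostSuc_conv)

lemma hist_pred: "m \<ge> 1 \<Longrightarrow> hist C m = hist C (m - 1) \<union> C m"
  using hist_Suc[of C "m - 1"] by simp

lemma subset_hist: "j \<in> {1..n} \<Longrightarrow> C j \<subseteq> hist C n"
  by (auto simp: hist_def)

lemma res_Un_sep: "res C l \<inter> sep C l = {}" "res C l \<union> sep C l = C l"
  by (auto simp: res_def sep_def)

locale perfect_model = loglinear V lev istar p
  for V :: "'v set" and lev :: "'v \<Rightarrow> 'a set" and istar p +
  fixes E :: "'v set set" and C :: "nat \<Rightarrow> 'v set" and k :: nat
  assumes perfect: "perfect_order V E C k" and markov: "markov V E lev p"
begin

lemma C_clique: "m \<in> {1..k} \<Longrightarrow> C m \<in> cliques V E"
  using perfect by (auto simp: perfect_order_def bij_betw_def)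

lemma C_subset: "m \<in> {1..k} \<Longrightarrow> C m \<subseteq> V"
  using C_clique by (auto simp: cliques_def)

lemma hist_subset: "m \<le> k \<Longrightarrow> hist C m \<subseteq> V"
  using C_subset by (force simp: hist_def)

lemma sep_subset_C: "sep C m \<subseteq> C m"
  by (auto simp: sep_def)

lemma sep_subset_earlier: "m \<in> {2..k} \<Longrightarrow> \<exists>j\<in>{1..<m}. sep C m \<subseteq> C j"
  using perfect by (auto simp: perfect_order_def)

lemma complete_subset_clique:
  assumes "complete_in E A" "A \<subseteq> V"
  shows "\<exists>m\<in>{1..k}. A \<subseteq> C m"
proof -
  let ?\<C> = "{B. B \<subseteq> V \<and> complete_in E B}"
  have "finite ?\<C>" using finite_V by auto
  then obtain B where B: "B \<in> ?\<C>" "A \<subseteq> B" "\<And>B'. B' \<in> ?\<C> \<Longrightarrow> B \<subseteq> B' \<Longrightarrow> B' = B"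
    using finite_has_maximal2[OF \<open>finite ?\<C>\<close>, of A] assms by (smt (verit) mem_Collect_eq)
  then have "B \<in> cliques V E" by (auto simp: cliques_def)
  then have "B \<in> C ` {1..k}"
    using perfect by (auto simp: perfect_order_def bij_betw_def)
  with B(2) show ?thesis by auto
qed

text \<open>A singleton is complete, so each vertex lies in some clique.\<close>

lemma hist_k: "hist C k = V"
proof
  show "V \<subseteq> hist C k"
  proof
    fix v assume "v \<in> V"
    then show "v \<in> hist C k"
      using complete_subset_clique[of "{v}"] by (auto simp: complete_in_def hist_def)
  qed
qed (simp add: hist_subset)

section \<open>Factorization over the cliques\<close>

text \<open>For non-adjacent \<gamma> and \<delta> in \<open>D\<close>, conditional independence
  writes the log probability as a signed sum of log marginals on sets missing \<gamma> or \<delta>.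
  None of these sets contains \<open>D\<close>, so all the transforms vanish.\<close>

lemma mobius_lm_not_complete:
  assumes "D \<subseteq> V" "\<not> complete_in E D" "i \<in> Pi D lev"
  shows "mobius (lm i V) D = 0"
proof -
  obtain \<gamma> \<delta> where \<gamma>\<delta>: "\<gamma> \<in> D" "\<delta> \<in> D" "\<gamma> \<noteq> \<delta>" "{\<gamma>, \<delta>} \<notin> E"
    using assms(2) by (auto simp: complete_in_def)
  have fin: "finite D" using assms(1) finite_V by (rule finite_subset)
  define B where "B = V - {\<gamma>, \<delta>}"
  have V: "{\<gamma>, \<delta>} \<union> B = V" "{\<gamma>} \<union> B = V - {\<delta>}" "{\<delta>} \<union> B = V - {\<gamma>}"
    using \<gamma>\<delta> assms(1) by (auto simp: B_def)
  have "lm i V F = lm i (V - {\<delta>}) F + lm i (V - {\<gamma>}) F - lm i B F" if "F \<subseteq> D" for F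
  proof -
    define x where "x = cell i V F"
    have i: "i \<in> Pi F lev" using assms(3) that by auto
    then have x: "x \<in> PiE V lev"
      unfolding x_def by (intro cell_in_PiE) auto
    have cond: "conditional V lev p A B (restrict x B) (restrict x A)
        = mg (A \<union> B) (cell i (A \<union> B) F) / mg B (cell i B F)" if "A \<union> B \<subseteq> V" for A
    proof -
      have "merge A B (restrict x A, restrict x B) = restrict x (A \<union> B)"
        by (auto simp: merge_def)
      moreover have "restrict x (A \<union> B) = cell i (A \<union> B) F" "restrict x B = cell i B F"
        using that by (auto simp: x_def restrict_cell)
      ultimately show ?thesis
        by (simp add: conditional_def)
    qed
    have "conditional V lev p {\<gamma>, \<delta>} B (restrict x B) (restrict x {\<gamma>, \<delta>}) =
        conditional V lev p {\<gamma>} B (restrict x B) (restrict x {\<gamma>}) *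
        conditional V lev p {\<delta>} B (restrict x B) (restrict x {\<delta>})"
      using markov x \<gamma>\<delta> assms(1) unfolding markov_def Let_def B_def by blast
    then have *: "mg V (cell i V F) / mg B (cell i B F) =
        mg (V - {\<delta>}) (cell i (V - {\<delta>}) F) / mg B (cell i B F) *
        (mg (V - {\<gamma>}) (cell i (V - {\<gamma>}) F) / mg B (cell i B F))"
      using cond[of "{\<gamma>, \<delta>}"] cond[of "{\<gamma>}"] cond[of "{\<delta>}"] unfolding V by simp
    have pos: "mg A (cell i A F) > 0" if "A \<subseteq> V" for A
      using that i by (rule marginal_cell_pos)
    have BV: "B \<subseteq> V" by (auto simp: B_def)
    have "mg V (cell i V F) * mg B (cell i B F)
        = mg (V - {\<delta>}) (cell i (V - {\<delta>}) F) * mg (V - {\<gamma>}) (cell i (V - {\<gamma>}) F)"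
      using * pos[OF BV] by (simp add: field_simps)
    then have "ln (mg V (cell i V F) * mg B (cell i B F))
        = ln (mg (V - {\<delta>}) (cell i (V - {\<delta>}) F) * mg (V - {\<gamma>}) (cell i (V - {\<gamma>}) F))"
      by simp
    then show ?thesis
      using pos[of V] pos[OF BV] pos[of "V - {\<delta>}"] pos[of "V - {\<gamma>}"]
      by (simp add: ln_mult_pos lm_def)
  qed
  then have "mobius (lm i V) D
      = mobius (\<lambda>F. lm i (V - {\<delta>}) F + lm i (V - {\<gamma>}) F - lm i B F) D"
    by (rule mobius_cong)
  also have "\<dots> = 0"
    using fin \<gamma>\<delta> by (simp add: mobius_add mobius_diff mobius_lm_eq_0 B_def subset_Diff_insert)
  finally show ?thesis .
qed

text \<open>Hammersley-Clifford; each interaction is charged to the first clique containing it.\<close>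

lemma clique_factorization:
  "\<exists>\<psi>. (\<forall>j\<in>{1..k}. \<forall>y\<in>PiE (C j) lev. \<psi> j y > 0) \<and>
       (\<forall>x\<in>PiE V lev. p x = (\<Prod>j\<in>{1..k}. \<psi> j (restrict x (C j)) :: real))"
proof -
  define \<D> where "\<D> = {D. D \<subseteq> V \<and> complete_in E D}"
  define first where "first D = (LEAST j. j \<in> {1..k} \<and> D \<subseteq> C j)" for D
  have first: "first D \<in> {1..k}" "D \<subseteq> C (first D)" if "D \<in> \<D>" for D
  proof -
    have "\<exists>j. j \<in> {1..k} \<and> D \<subseteq> C j"
      using that complete_subset_clique unfolding \<D>_def by blast
    then have "first D \<in> {1..k} \<and> D \<subseteq> C (first D)"
      unfolding first_def by (rule LeastI_ex)
    then show "first D \<in> {1..k}" "D \<subseteq> C (first D)" by auto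
  qed
  \<comment> \<open>A cell \<open>y\<close> of \<open>C j\<close> may stand in for a cell of
    \<open>V\<close>, as the transform at \<open>D \<subseteq> C j\<close> reads it only on
    \<open>D\<close>.\<close>
  define \<psi> where "\<psi> j y = exp (\<Sum>D\<in>{D\<in>\<D>. first D = j}. mobius (lm y V) D)" for j y
  have fin: "finite \<D>"
    using finite_V by (auto simp: \<D>_def)
  have "p x = (\<Prod>j\<in>{1..k}. \<psi> j (restrict x (C j)))" if x: "x \<in> PiE V lev" for x
  proof -
    have "ln (p x) = (\<Sum>D\<in>\<D>. mobius (lm x V) D)"
      unfolding ln_eq_sum_mobius[OF x] using finite_V x
      by (intro sum.mono_neutral_right) (auto simp: \<D>_def intro!: mobius_lm_not_complete)
    also have "\<dots> = (\<Sum>j\<in>{1..k}. \<Sum>D\<in>{D\<in>\<D>. first D = j}. mobius (lm x V) D)"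
      using fin first by (intro sum.group[symmetric]) auto
    also have "\<dots> = (\<Sum>j\<in>{1..k}. \<Sum>D\<in>{D\<in>\<D>. first D = j}. mobius (lm (restrict x (C j)) V) D)"
      using first(2) by (intro sum.cong refl mobius_lm_cong) auto
    finally have "exp (ln (p x)) = (\<Prod>j\<in>{1..k}. \<psi> j (restrict x (C j)))"
      by (simp add: \<psi>_def exp_sum)
    moreover have "p x > 0"
      using pos_prob x by (auto simp: pos_prob_def)
    ultimately show ?thesis by simp
  qed
  then show ?thesis
    by (intro exI[of _ \<psi>]) (simp add: \<psi>_def)
qed

text \<open>Summing out the residual of the last clique leaves a factor on its separator, which is
  absorbed into an earlier clique containing it.\<close>

lemma hist_factorization:
  assumes "1 \<le> m" "m \<le> k"
  shows "\<exists>\<psi>. (\<forall>j\<in>{1..m}. \<forall>y\<in>PiE (C j) lev. \<psi> j y > 0) \<and>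
       (\<forall>x\<in>PiE (hist C m) lev. mg (hist C m) x = (\<Prod>j\<in>{1..m}. \<psi> j (restrict x (C j)) :: real))"
  using assms(2,1)
\<comment> \<open>Downwards from \<open>k\<close>, where the history is all of \<open>V\<close> and
  the factorization of \<open>p\<close> applies.\<close>
proof (induction rule: inc_induct)
  case base
  obtain \<psi> where "\<forall>j\<in>{1..k}. \<forall>y\<in>PiE (C j) lev. \<psi> j y > 0"
    and "\<forall>x\<in>PiE V lev. p x = (\<Prod>j\<in>{1..k}. \<psi> j (restrict x (C j)) :: real)"
    using clique_factorization by (elim exE conjE) (rule that)
  then show ?case
    unfolding hist_k by (intro exI[of _ \<psi>]) (auto simp only: marginal_V)
next
  case (step n)
  let ?A = "hist C n" and ?B = "C (Suc n)"
  have "1 \<le> Suc n" by simp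
  from step.IH[OF this] obtain \<psi> where \<psi>_pos: "\<forall>j\<in>{1..Suc n}. \<forall>y\<in>PiE (C j) lev. \<psi> j y > 0"
    and \<psi>_prod: "\<forall>x\<in>PiE (hist C (Suc n)) lev.
      mg (hist C (Suc n)) x = (\<Prod>j\<in>{1..Suc n}. \<psi> j (restrict x (C j)) :: real)"
    by (elim exE conjE) (rule that)
  have pos: "\<psi> j y > 0" if "j \<in> {1..Suc n}" "y \<in> PiE (C j) lev" for j y
    using \<psi>_pos that by blast
  have \<psi>: "mg (hist C (Suc n)) x = (\<Prod>j\<in>{1..Suc n}. \<psi> j (restrict x (C j)))"
    if "x \<in> PiE (hist C (Suc n)) lev" for x
    using \<psi>_prod that by blast
  have n: "n < k" "1 \<le> n" by fact+
  have sub: "hist C (Suc n) = ?A \<union> ?B" "?A \<union> ?B \<subseteq> V" "?A \<inter> ?B = sep C (Suc n)"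
    using hist_subset[of "Suc n"] n by (auto simp: hist_Suc sep_def)
  obtain r where r: "r \<in> {1..n}" "sep C (Suc n) \<subseteq> C r"
    using sep_subset_earlier[of "Suc n"] n by (auto simp: less_Suc_eq_le)
  define g where "g s = (\<Sum>b\<in>{b\<in>PiE ?B lev. restrict b (sep C (Suc n)) = s}. \<psi> (Suc n) b)" for s
  define \<phi> where "\<phi> j y = \<psi> j y * (if j = r then g (restrict y (sep C (Suc n))) else 1)" for j y
  have g_pos: "g s > 0" if s: "s \<in> PiE (sep C (Suc n)) lev" for s
    unfolding g_def
  proof (rule sum_pos)
    show "finite {b\<in>PiE ?B lev. restrict b (sep C (Suc n)) = s}"
      using finite_PiE_lev[of ?B] sub(2) by simp
    have "merge (sep C (Suc n)) (?B - sep C (Suc n)) (s, istar)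
        \<in> {b\<in>PiE ?B lev. restrict b (sep C (Suc n)) = s}"
      using s sub istar sep_subset_C[of "Suc n"]
      by (auto simp: merge_def PiE_iff extensional_def fun_eq_iff)
    then show "{b\<in>PiE ?B lev. restrict b (sep C (Suc n)) = s} \<noteq> {}" by blast
  qed (use pos[of "Suc n"] in auto)
  have "\<phi> j y > 0" if "j \<in> {1..n}" "y \<in> PiE (C j) lev" for j y
    using pos[of j y] g_pos that r restrict_in_PiE[of y "C r" lev "sep C (Suc n)"]
    by (auto simp: \<phi>_def)
  moreover have "mg ?A x = (\<Prod>j\<in>{1..n}. \<phi> j (restrict x (C j)))" if x: "x \<in> PiE ?A lev" for x
  proof -
    have "mg ?A x = (\<Sum>z\<in>{z\<in>PiE (?A \<union> ?B) lev. restrict z ?A = x}.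
        (\<Prod>j\<in>{1..n}. \<psi> j (restrict x (C j))) * \<psi> (Suc n) (restrict z ?B))"
      unfolding marginal_tower[OF Un_upper1 sub(2), of x]
    proof (intro sum.cong refl)
      fix z assume z: "z \<in> {z\<in>PiE (?A \<union> ?B) lev. restrict z ?A = x}"
      have "restrict z (C j) = restrict x (C j)" if "j \<in> {1..n}" for j
      proof -
        have "x = restrict z ?A" using z by simp
        then show ?thesis
          using subset_hist[OF that, of C] by (simp only: restrict_restrict inf.absorb2)
      qed
      then have *: "(\<Prod>j\<in>{1..n}. \<psi> j (restrict z (C j))) = (\<Prod>j\<in>{1..n}. \<psi> j (restrict x (C j)))"
        by (intro prod.cong refl) simp
      have "mg (?A \<union> ?B) z = (\<Prod>j\<in>{1..Suc n}. \<psi> j (restrict z (C j)))"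
        using \<psi>[of z] z unfolding sub(1) by blast
      also have "{1..Suc n} = insert (Suc n) {1..n}" by auto
      also have "(\<Prod>j\<in>insert (Suc n) {1..n}. \<psi> j (restrict z (C j)))
          = \<psi> (Suc n) (restrict z ?B) * (\<Prod>j\<in>{1..n}. \<psi> j (restrict z (C j)))"
        by (rule prod.insert) auto
      finally show "mg (?A \<union> ?B) z
          = (\<Prod>j\<in>{1..n}. \<psi> j (restrict x (C j))) * \<psi> (Suc n) (restrict z ?B)"
        unfolding * by (simp only: mult.commute)
    qed
    also have "\<dots> = (\<Prod>j\<in>{1..n}. \<psi> j (restrict x (C j))) * g (restrict x (sep C (Suc n)))"
      using sum_restrict_Un[OF x, of "\<psi> (Suc n)" ?B]
      by (simp add: sum_distrib_left[symmetric] g_def sub(3))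
    \<comment> \<open>Written as a product with a single nontrivial factor, at \<open>r\<close>, so
      that it distributes into \<open>\<phi>\<close>.\<close>
    also have "g (restrict x (sep C (Suc n)))
        = (\<Prod>j\<in>{1..n}. if j = r then g (restrict (restrict x (C j)) (sep C (Suc n))) else 1)"
      using r by (simp add: prod.delta inf.absorb2)
    finally show ?thesis
      unfolding \<phi>_def prod.distrib .
  qed
  ultimately show ?case
    by (intro exI[of _ \<phi>] conjI ballI)
qed

section \<open>Log marginals along the perfect order\<close>

text \<open>The marginal on \<open>hist C l\<close> is a product over the earlier cliques times
  \<open>\<psi> l\<close>. Summing out the vertices outside \<open>A\<close> touches only the first
  factor, as \<open>C l \<subseteq> A\<close>. So \<open>lm_factor\<close> applies to
  \<open>A \<inter> hist C (l - 1)\<close> and \<open>C l\<close>, whose union is \<open>A\<close>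
  and whose intersection is the separator.\<close>

lemma lm_between:
  assumes l: "l \<in> {1..k}" and A: "C l \<subseteq> A" "A \<subseteq> hist C l" and i: "i \<in> Pi F lev"
  shows "lm i A F + lm i (sep C l) F = lm i (A \<inter> hist C (l - 1)) F + lm i (C l) F"
proof -
  let ?H = "hist C (l - 1)"
  obtain \<psi> where \<psi>: "\<And>x. x \<in> PiE (hist C l) lev \<Longrightarrow>
      mg (hist C l) x = (\<Prod>j\<in>{1..l}. \<psi> j (restrict x (C j)) :: real)"
    using hist_factorization[of l] l by auto
  have H: "hist C l = ?H \<union> C l" "hist C l \<subseteq> V"
    using l by (intro hist_pred hist_subset; simp)+
  have AH: "A \<union> ?H = hist C l" "A \<inter> ?H \<union> C l = A" "A \<inter> ?H \<inter> C l = sep C l" "A \<subseteq> V"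
    using A H by (auto simp: sep_def)
  define f where "f y = (\<Prod>j\<in>{1..l - 1}. \<psi> j (restrict y (C j)))" for y
  define f' where "f' s = (\<Sum>b\<in>{b\<in>PiE ?H lev. restrict b (A \<inter> ?H) = s}. f b)" for s
  have fact: "mg (hist C l) z = f (restrict z ?H) * \<psi> l (restrict z (C l))"
    if "z \<in> PiE (hist C l) lev" for z
  proof -
    have "restrict (restrict z ?H) (C j) = restrict z (C j)" if "j \<in> {1..l - 1}" for j
      using subset_hist[OF that, of C] by (simp add: inf.absorb2)
    moreover have "{1..l} = insert l {1..l - 1}" "l \<notin> {1..l - 1}" using l by auto
    ultimately show ?thesis
      using \<psi>[OF that] by (simp add: f_def)
  qed
  have "mg A x = f' (restrict x (A \<inter> ?H)) * \<psi> l (restrict x (C l))" if x: "x \<in> PiE A lev" for x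
  proof -
    have "mg A x = (\<Sum>z\<in>{z\<in>PiE (hist C l) lev. restrict z A = x}.
        f (restrict z ?H) * \<psi> l (restrict x (C l)))"
      unfolding marginal_tower[OF A(2) H(2), of x]
      using A(1) fact by (intro sum.cong refl) (auto simp: inf.absorb2)
    also have "\<dots> = f' (restrict x (A \<inter> ?H)) * \<psi> l (restrict x (C l))"
      using sum_restrict_Un[OF x, of f ?H] unfolding AH(1)
      by (simp add: sum_distrib_right[symmetric] f'_def)
    finally show ?thesis .
  qed
  then have "lm i (A \<inter> ?H \<union> C l) F + lm i (A \<inter> ?H \<inter> C l) F = lm i (A \<inter> ?H) F + lm i (C l) F"
    by (intro lm_factor[where f = f' and g = "\<psi> l", OF _ _ i]) (simp_all only: AH)
  then show ?thesis
    unfolding AH(2,3) .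
qed

text \<open>Telescoping of \<open>lm_between\<close> with \<open>A = hist C m\<close>.\<close>

lemma lm_hist:
  assumes "m \<le> k" "i \<in> Pi F lev"
  shows "lm i (hist C m) F = (\<Sum>j\<in>{1..m}. lm i (C j) F - lm i (sep C j) F)"
  using assms(1)
proof (induction m)
  case 0
  have "cell i {} F = (\<lambda>_. undefined)"
    by (auto simp: merge_def)
  then show ?case by (simp add: lm_def marginal_empty)
next
  case (Suc m)
  have "hist C (Suc m) \<inter> hist C m = hist C m"
    by (auto simp: hist_Suc)
  then show ?case
    using lm_between[of "Suc m" "hist C (Suc m)" i F] Suc assms(2)
    by (simp add: hist_Suc)
qed

text \<open>Taking Moebius transforms of
  \<open>ln p = \<Sum>\<^sub>m (ln p\<^bsup>C\<^sub>m\<^esup> - ln p\<^bsup>S\<^sub>m\<^esup>)\<close>; the terms with \<open>D \<not>\<subseteq> C\<^sub>m\<close> vanish.\<close>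

lemma mobius_lm_V:
  assumes "D \<subseteq> V" "i \<in> Pi D lev"
  shows "mobius (lm i V) D
    = (\<Sum>m\<in>{m\<in>{1..k}. D \<subseteq> C m}. mobius (lm i (C m)) D - mobius (lm i (sep C m)) D)"
proof -
  have fin: "finite D" using assms(1) finite_V by (rule finite_subset)
  have "mobius (lm i V) D = mobius (\<lambda>F. \<Sum>m\<in>{1..k}. lm i (C m) F - lm i (sep C m) F) D"
  proof (rule mobius_cong)
    fix F assume "F \<subseteq> D"
    then have "i \<in> Pi F lev" using assms(2) by auto
    then show "lm i V F = (\<Sum>m\<in>{1..k}. lm i (C m) F - lm i (sep C m) F)"
      using lm_hist[of k i F] by (simp add: hist_k)
  qed
  also have "\<dots> = (\<Sum>m\<in>{1..k}. mobius (lm i (C m)) D - mobius (lm i (sep C m)) D)"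
    by (simp add: mobius_sum mobius_diff)
  also have "\<dots> = (\<Sum>m\<in>{m\<in>{1..k}. D \<subseteq> C m}. mobius (lm i (C m)) D - mobius (lm i (sep C m)) D)"
  proof (intro sum.mono_neutral_right ballI)
    fix m assume "m \<in> {1..k} - {m\<in>{1..k}. D \<subseteq> C m}"
    then have "\<not> D \<subseteq> C m" "\<not> D \<subseteq> sep C m"
      using sep_subset_C by auto
    then show "mobius (lm i (C m)) D - mobius (lm i (sep C m)) D = 0"
      using fin by (simp add: mobius_lm_eq_0)
  qed auto
  finally show ?thesis .
qed

section \<open>Joint parameters from clique marginals\<close>

text \<open>A single clique contributes to \<open>mobius_lm_V\<close>. Its separator cannot contain
  \<open>D\<close>, being empty for \<open>l = 1\<close> and otherwise inside an earlier clique, so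
  only the clique term survives.\<close>

lemma theta_eq_theta_marg:
  assumes "D \<noteq> {}" "{m\<in>{1..k}. D \<subseteq> C m} = {l}" "i \<in> Pi D lev"
  shows "theta V istar p D i = theta_marg V lev istar p (C l) D i"
proof -
  have l: "l \<in> {1..k}" "D \<subseteq> C l" and un: "\<And>m. m \<in> {1..k} \<Longrightarrow> D \<subseteq> C m \<Longrightarrow> m = l"
    using assms(2) by blast+
  have D: "D \<subseteq> V"
    using C_subset[OF l(1)] l(2) by auto
  have fin: "finite D"
    using D finite_V by (rule finite_subset)
  have "\<not> D \<subseteq> sep C l"
  proof (cases "l = 1")
    case True
    then show ?thesis using assms(1) by (simp add: sep_def)
  next
    case False
    then obtain j where j: "j \<in> {1..<l}" "sep C l \<subseteq> C j"
      using sep_subset_earlier[of l] l(1) by auto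
    then have "j \<in> {1..k}" using l(1) by auto
    then show ?thesis using un[of j] j by auto
  qed
  then have "mobius (lm i V) D = mobius (lm i (C l)) D"
    using mobius_lm_V[OF D assms(3)] fin unfolding assms(2) by (simp add: mobius_lm_eq_0)
  then show ?thesis
    using D l(2) assms(3) C_subset[OF l(1)] by (simp add: theta_eq theta_marg_eq)
qed

text \<open>Each summand of \<open>mobius_lm_V\<close> involves only the marginal on
  \<open>C m\<close>. The parameters fix that marginal up to a factor, which cancels since
  \<open>D\<close> is nonempty.\<close>

lemma theta_determined:
  assumes q: "perfect_model V lev istar q E C k" and D: "D \<noteq> {}" "D \<subseteq> V" and i: "i \<in> Pi D lev"
    and eq: "\<And>m B y. m \<in> {1..k} \<Longrightarrow> D \<subseteq> C m \<Longrightarrow> B \<noteq> {} \<Longrightarrow> B \<subseteq> C m \<Longrightarrow>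
      y \<in> nz_cells lev istar B \<Longrightarrow>
      theta_marg V lev istar p (C m) B y = theta_marg V lev istar q (C m) B y"
  shows "theta V istar p D i = theta V istar q D i"
proof -
  interpret q: perfect_model V lev istar q E C k by (rule q)
  have fin: "finite D" using D(2) finite_V by (rule finite_subset)
  have "mobius (lm i (C m)) D - mobius (lm i (sep C m)) D
      = mobius (q.lm i (C m)) D - mobius (q.lm i (sep C m)) D" if m: "m \<in> {1..k}" "D \<subseteq> C m" for m
  proof -
    have Cm: "C m \<subseteq> V" using m C_subset by auto
    have ll: "loglinear V lev istar q" by unfold_locales
    obtain c where c: "c > 0" "\<And>x. x \<in> PiE (C m) lev \<Longrightarrow> mg (C m) x = c * marginal V lev q (C m) x"
      using marginal_determined[OF Cm ll eq[OF m]] by blast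
    have "mobius (lm i (C m)) D = mobius (q.lm i (C m)) D"
      using mobius_lm_scaled[OF Cm D(1) fin i ll c] by simp
    moreover have "mobius (lm i (sep C m)) D = mobius (q.lm i (sep C m)) D"
      using Cm sep_subset_C[of m]
      by (intro mobius_lm_scaled[OF _ D(1) fin i ll c(1)]
          marginal_scaled_subset[OF sep_subset_C Cm ll c(2)]) auto
    ultimately show ?thesis by simp
  qed
  then have "mobius (lm i V) D = mobius (q.lm i V) D"
    using mobius_lm_V[OF D(2) i] q.mobius_lm_V[OF D(2) i] by simp
  then show ?thesis
    using D(2) i by (simp add: theta_eq q.theta_eq)
qed

text \<open>Only \<open>p\<^bsup>R\<^sub>l|S\<^sub>l\<^esup>\<close> contributes: the other factor of \<open>p\<^bsup>A\<^esup>\<close> does not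
  involve \<open>R\<^sub>l\<close>.\<close>

lemma mobius_lm_between:
  assumes l: "l \<in> {1..k}" and A: "C l \<subseteq> A" "A \<subseteq> hist C l"
    and D: "D \<subseteq> C l" "D \<inter> res C l \<noteq> {}" and i: "i \<in> Pi D lev"
  shows "mobius (lm i A) D = theta_marg V lev istar p (C l) D i"
proof -
  have fin: "finite D"
    using D(1) C_subset[OF l] finite_V by (meson finite_subset)
  have n: "\<not> D \<subseteq> A \<inter> hist C (l - 1)" "\<not> D \<subseteq> sep C l"
    using D by (auto simp: res_def sep_def)
  have "mobius (\<lambda>F. lm i A F + lm i (sep C l) F) D
      = mobius (\<lambda>F. lm i (A \<inter> hist C (l - 1)) F + lm i (C l) F) D"
  proof (rule mobius_cong)
    fix F assume "F \<subseteq> D"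
    then have "i \<in> Pi F lev" using i by auto
    then show "lm i A F + lm i (sep C l) F = lm i (A \<inter> hist C (l - 1)) F + lm i (C l) F"
      by (rule lm_between[OF l A])
  qed
  then show ?thesis
    using fin n C_subset[OF l] D(1) i by (simp add: mobius_add mobius_lm_eq_0 theta_marg_eq)
qed

text \<open>By \<open>theta_determined\<close> the value is constant on models sharing the parameter
  family, so it factors through that family.\<close>

lemma expressible:
  assumes "D \<noteq> {}" "D \<subseteq> V" "i \<in> Pi D lev"
  shows "expressible_from V E lev istar C {m\<in>{1..k}. D \<subseteq> C m} D i"
proof -
  define Q where "Q q \<longleftrightarrow> pos_prob V lev q \<and> markov V E lev q" for q :: "('v \<Rightarrow> 'a) \<Rightarrow> real"
  define par where "par q = (\<lambda>m B y. if m \<in> {m\<in>{1..k}. D \<subseteq> C m} \<and> B \<noteq> {} \<and> B \<subseteq> C m \<and>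
      y \<in> nz_cells lev istar B then theta_marg V lev istar q (C m) B y else 0)" for q
  have "theta V istar q D i = theta V istar q' D i" if "Q q" "Q q'" "par q = par q'" for q q'
  proof -
    have model: "perfect_model V lev istar r E C k" if "Q r" for r
      using that finite_V finite_lev istar perfect by unfold_locales (auto simp: Q_def)
    interpret q: perfect_model V lev istar q E C k by (rule model[OF that(1)])
    have "par q m B y = par q' m B y" for m B y
      using that(3) by simp
    then have "theta_marg V lev istar q (C m) B y = theta_marg V lev istar q' (C m) B y"
      if "m \<in> {1..k}" "D \<subseteq> C m" "B \<noteq> {}" "B \<subseteq> C m" "y \<in> nz_cells lev istar B" for m B y
      using that by (simp add: par_def split: if_splits) metis
    then show ?thesis
      by (intro q.theta_determined[OF model[OF that(2)] assms])
  qed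
  \<comment> \<open>The required function picks any model with the given parameters and returns its
    \<open>theta\<close>.\<close>
  then have "theta V istar q D i = theta V istar (SOME q'. Q q' \<and> par q' = par q) D i" if "Q q" for q
    using that by (metis (mono_tags, lifting) someI)
  then show ?thesis
    unfolding expressible_from_def
    by (intro exI[of _ "\<lambda>v. theta V istar (SOME q'. Q q' \<and> par q' = v) D i"])
      (simp add: Q_def par_def)
qed

text \<open>These bounds allow \<open>A = V - C_later C k l\<close> in
  \<open>mobius_lm_between\<close>. That set may be strictly smaller than \<open>hist C l\<close>,
  since a vertex outside \<open>C l\<close> can lie in both an earlier and a later clique; hence the
  flexible \<open>A\<close> there.\<close>

lemma C_later_bounds:
  assumes "l \<in> {1..k}"
  shows "C_later C k l \<subseteq> V" "C l \<subseteq> V - C_later C k l" "V - C_later C k l \<subseteq> hist C l"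
proof -
  show "C_later C k l \<subseteq> V"
  proof -
    have "C m \<subseteq> V" if "m \<in> {l+1..k}" for m
      using that by (intro C_subset) simp
    then show ?thesis unfolding C_later_def by blast
  qed
  show "C l \<subseteq> V - C_later C k l"
    using C_subset[OF assms] by (auto simp: C_later_def)
  show "V - C_later C k l \<subseteq> hist C l"
  proof
    fix v assume v: "v \<in> V - C_later C k l"
    then obtain m where m: "m \<in> {1..k}" "v \<in> C m"
      using hist_k by (auto simp: hist_def)
    then show "v \<in> hist C l"
      using v assms by (cases "m \<le> l") (auto simp: hist_def C_later_def)
  qed
qed

end

section \<open>Assembly of (a), (b) and the parameters entering \<open>k_l\<close>\<close>

text \<open>In the last clause a non-complete \<open>H \<union> M\<close> lies in no clique, hence
  the separate value 0; for a complete one, \<open>J\<close> lists the cliques whose marginals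
  determine the parameter.\<close>

theorem proposition2p3:
  fixes V :: "'v set" and E :: "'v set set"
    and lev :: "'v \<Rightarrow> 'a set" and istar :: "'v \<Rightarrow> 'a"
    and p :: "('v \<Rightarrow> 'a) \<Rightarrow> real"
    and C :: "nat \<Rightarrow> 'v set" and k l :: nat
    and D :: "'v set" and i :: "'v \<Rightarrow> 'a"
  assumes "finite V" and "V \<noteq> {}"
    and "\<And>\<gamma>. \<gamma> \<in> V \<Longrightarrow> finite (lev \<gamma>)" and "\<And>\<gamma>. \<gamma> \<in> V \<Longrightarrow> istar \<gamma> \<in> lev \<gamma>"
    and "simple_graph V E" and "decomposable E V" and "perfect_order V E C k"
    and "pos_prob V lev p" and "markov V E lev p"
    and "l \<in> {1..k}" and "D \<subseteq> C l" and "D \<inter> res C l \<noteq> {}" and "i \<in> nz_cells lev istar D"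
  shows
    \<comment> \<open>(a), followed by its equivalent form\<close>
    "(2 \<le> l \<longrightarrow>
        theta_marg V lev istar p (C l) D i =
          (\<Sum>F\<in>Pow (D \<inter> sep C l). (- 1) ^ card ((D \<inter> sep C l) - F) *
             theta_cond V lev istar p (res C l) (sep C l)
               (merge F (sep C l - F) (i, istar)) (D \<inter> res C l) i)) \<and>
     (2 \<le> l \<longrightarrow>
        (\<forall>D' F i' f. D' \<noteq> {} \<and> D' \<subseteq> res C l \<and> i' \<in> nz_cells lev istar D' \<and>
           F \<subseteq> sep C l \<and> f \<in> nz_cells lev istar F \<longrightarrow>
           theta_cond V lev istar p (res C l) (sep C l)
               (merge F (sep C l - F) (f, istar)) D' i' =
             (\<Sum>H\<in>Pow F. theta_marg V lev istar p (C l) (H \<union> D') (merge H D' (f, i'))))) \<and>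
     \<comment> \<open>(b)(i)\<close>
     ((\<forall>j\<in>later C k l. \<not> D \<subseteq> sep C j) \<longrightarrow>
        theta V istar p D i = theta_marg V lev istar p (C l) D i) \<and>
     \<comment> \<open>(b)(ii)\<close>
     ((\<exists>m\<in>later C k l. D \<subseteq> sep C m) \<longrightarrow>
        theta V istar p D i = theta_marg V lev istar p (C l) D i -
          (\<Sum>F\<in>Pow D. (- 1) ^ card (D - F) * k_fun V lev istar p (C_later C k l) F i)) \<and>
     \<comment> \<open>the parameters entering \<open>k_l\<close>\<close>
     (\<forall>H M j. H \<subseteq> D \<and> M \<noteq> {} \<and> M \<subseteq> C_later C k l \<and> j \<in> nz_cells lev istar M \<longrightarrow>
        (\<not> complete_in E (H \<union> M) \<longrightarrow> theta V istar p (H \<union> M) (merge H M (i, j)) = 0) \<and>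
        (complete_in E (H \<union> M) \<longrightarrow>
          (let J = {m\<in>{1..k}. H \<union> M \<subseteq> C m} in
             J \<noteq> {} \<and> l \<notin> J \<and>
             (\<not> M \<subseteq> hist C (l - 1) \<longrightarrow> J \<subseteq> {l+1..k}) \<and>
             (\<not> M \<subseteq> hist C (l - 1) \<and> H \<noteq> {} \<longrightarrow> J \<subseteq> later C k l) \<and>
             (\<forall>m. J = {m} \<longrightarrow> theta V istar p (H \<union> M) (merge H M (i, j)) =
                theta_marg V lev istar p (C m) (H \<union> M) (merge H M (i, j))) \<and>
             expressible_from V E lev istar C J (H \<union> M) (merge H M (i, j)))))"
proof -
  interpret perfect_model V lev istar p E C k
    using assms by unfold_locales auto
  note l = \<open>l \<in> {1..k}\<close> and D = \<open>D \<subseteq> C l\<close> \<open>D \<inter> res C l \<noteq> {}\<close>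
  have Cl: "C l \<subseteq> V" using C_subset[OF l] .
  have i: "i \<in> Pi D lev" using assms(13) by (auto simp: nz_cells_def)
  have nz: "x \<in> Pi B lev" if "x \<in> nz_cells lev istar B" for x B
    using that by (auto simp: nz_cells_def)
  have RS: "res C l \<union> sep C l \<subseteq> V" unfolding res_Un_sep(2) by (rule Cl)
  have a: "theta_marg V lev istar p (C l) D i =
      (\<Sum>F\<in>Pow (D \<inter> sep C l). (- 1) ^ card ((D \<inter> sep C l) - F) *
         theta_cond V lev istar p (res C l) (sep C l)
           (merge F (sep C l - F) (i, istar)) (D \<inter> res C l) i)"
    using theta_marg_eq_sum_theta_cond[OF res_Un_sep(1) RS _ D(2) i] D(1)
    by (simp add: res_Un_sep(2))
  have a': "theta_cond V lev istar p (res C l) (sep C l) (merge F (sep C l - F) (f, istar)) D' i' =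
      (\<Sum>H\<in>Pow F. theta_marg V lev istar p (C l) (H \<union> D') (merge H D' (f, i')))"
    if "D' \<noteq> {}" "D' \<subseteq> res C l" "i' \<in> nz_cells lev istar D'" "F \<subseteq> sep C l"
      "f \<in> nz_cells lev istar F" for D' F i' f
    using theta_cond_eq_sum_theta_marg[OF res_Un_sep(1) RS that(2,1,4) nz[OF that(3)] nz[OF that(5)]]
    by (simp add: res_Un_sep(2))
  have b1: "theta V istar p D i = theta_marg V lev istar p (C l) D i"
    if later: "\<forall>j\<in>later C k l. \<not> D \<subseteq> sep C j"
  proof -
    \<comment> \<open>An earlier clique containing \<open>D\<close> contradicts that
      \<open>D\<close> meets the residual; a later one would put \<open>D\<close> into its
      separator.\<close>
    have "m = l" if m: "m \<in> {1..k}" "D \<subseteq> C m" for m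
    proof (rule ccontr)
      assume "m \<noteq> l"
      then consider "m \<in> {1..l - 1}" | "l \<in> {1..m - 1}" "m > l" using m l by force
      then show False
      proof cases
        case 1
        then show False using D m(2) subset_hist[of m "l - 1" C] by (auto simp: res_def sep_def)
      next
        case 2
        then have "m \<in> later C k l"
          using m D by (auto simp: later_def)
        moreover have "D \<subseteq> sep C m"
          using m D subset_hist[OF 2(1), of C] by (auto simp: sep_def)
        ultimately show False using later by auto
      qed
    qed
    then have "{m\<in>{1..k}. D \<subseteq> C m} = {l}" using l D by blast
    then show ?thesis using D i by (intro theta_eq_theta_marg) auto
  qed
  \<comment> \<open>The transform on \<open>V - C_later C k l\<close> is evaluated twice: the
    residual argument gives the clique parameter, summing out gives \<open>theta\<close> plus the
    \<open>k_fun\<close> term.\<close>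
  have b2: "theta V istar p D i = theta_marg V lev istar p (C l) D i -
      (\<Sum>F\<in>Pow D. (- 1) ^ card (D - F) * k_fun V lev istar p (C_later C k l) F i)"
    using mobius_lm_between[OF l C_later_bounds(2,3)[OF l] D i]
      mobius_lm_Diff[OF C_later_bounds(1)[OF l] order_trans[OF D(1) C_later_bounds(2)[OF l]] i]
    by (simp add: mobius_def)
  have par: "(\<not> complete_in E (H \<union> M) \<longrightarrow> theta V istar p (H \<union> M) (merge H M (i, j)) = 0) \<and>
      (complete_in E (H \<union> M) \<longrightarrow>
        (let J = {m\<in>{1..k}. H \<union> M \<subseteq> C m} in
           J \<noteq> {} \<and> l \<notin> J \<and>
           (\<not> M \<subseteq> hist C (l - 1) \<longrightarrow> J \<subseteq> {l+1..k}) \<and>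
           (\<not> M \<subseteq> hist C (l - 1) \<and> H \<noteq> {} \<longrightarrow> J \<subseteq> later C k l) \<and>
           (\<forall>m. J = {m} \<longrightarrow> theta V istar p (H \<union> M) (merge H M (i, j)) =
              theta_marg V lev istar p (C m) (H \<union> M) (merge H M (i, j))) \<and>
           expressible_from V E lev istar C J (H \<union> M) (merge H M (i, j))))"
    if H: "H \<subseteq> D" and M: "M \<noteq> {}" "M \<subseteq> C_later C k l" and j: "j \<in> nz_cells lev istar M" for H M j
  proof -
    define J where "J = {m\<in>{1..k}. H \<union> M \<subseteq> C m}"
    have disj: "M \<inter> C l = {}" "H \<inter> M = {}"
      using M C_later_bounds(2)[OF l] H D(1) by auto
    have HM: "H \<union> M \<noteq> {}" "H \<union> M \<subseteq> V"
      using M C_later_bounds(1)[OF l] H D(1) Cl by auto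
    have x: "merge H M (i, j) \<in> Pi (H \<union> M) lev"
      using disj i H nz[OF j] by (auto simp: merge_def)
    have l_notin: "l \<notin> J"
      using disj(1) M(1) by (auto simp: J_def)
    have not_complete: "theta V istar p (H \<union> M) (merge H M (i, j)) = 0"
      if "\<not> complete_in E (H \<union> M)"
      using mobius_lm_not_complete[OF HM(2) that x] theta_eq[OF HM(2) x] by simp
    have J_nonempty: "J \<noteq> {}" if "complete_in E (H \<union> M)"
      using complete_subset_clique[OF that HM(2)] by (auto simp: J_def)
    \<comment> \<open>An earlier clique would put \<open>M\<close> into
      \<open>hist C (l - 1)\<close>, and \<open>C l\<close> is disjoint from the nonempty
      \<open>M\<close>.\<close>
    have J_gt: "J \<subseteq> {l+1..k}" if "\<not> M \<subseteq> hist C (l - 1)"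
    proof
      fix m assume m: "m \<in> J"
      then have "m \<notin> {1..l - 1}"
        using that subset_hist[of m "l - 1" C] by (auto simp: J_def)
      moreover have "m \<noteq> l" "m \<in> {1..k}"
        using m l_notin by (auto simp: J_def)
      ultimately show "m \<in> {l+1..k}" by force
    qed
    \<comment> \<open>A nonempty \<open>H\<close> witnesses that \<open>C m\<close> meets
      \<open>C l\<close>.\<close>
    have J_later: "J \<subseteq> later C k l" if "\<not> M \<subseteq> hist C (l - 1) \<and> H \<noteq> {}"
    proof
      fix m assume m: "m \<in> J"
      then have "H \<subseteq> C l \<inter> C m"
        using H D(1) by (auto simp: J_def)
      then show "m \<in> later C k l"
        using m J_gt that by (auto simp: later_def)
    qed
    have single: "theta V istar p (H \<union> M) (merge H M (i, j)) =
        theta_marg V lev istar p (C m) (H \<union> M) (merge H M (i, j))" if "J = {m}" for m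
      using theta_eq_theta_marg[OF HM(1) that[unfolded J_def] x] .
    have expr: "expressible_from V E lev istar C J (H \<union> M) (merge H M (i, j))"
      unfolding J_def by (rule expressible[OF HM x])
    show ?thesis
      unfolding Let_def J_def[symmetric]
      by (intro conjI impI allI not_complete J_nonempty l_notin J_gt J_later single expr) simp_all
  qed
  show ?thesis
    by (rule conjI, rule impI, rule a,
        rule conjI, intro impI allI, elim conjE, rule a', assumption+,
        rule conjI, rule impI, rule b1, assumption,
        rule conjI, rule impI, rule b2,
        intro impI allI, elim conjE, rule par, assumption+)
qed

end
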